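(* Let $k\ge 2$ and $n\ge 1$ be integers and let $\phi,\psi\in L^\infty(\mathbb{T}^n)$. Then $\mathcal{S}_\phi^{k,n}\mathcal{S}_\psi^{k,n}=\mathcal{S}_\psi^{k,n}\mathcal{S}_\phi^{k,n}$ if and only if $\phi(z^{-k})\psi(z)=\psi(z^{-k})\phi(z)$ (as elements of $L^\infty(\mathbb{T}^n)$).
   Context: $\mathbb{T}^n$ is the $n$-torus with normalized Haar measure; $e_m(z)=z^m=z_1^{m_1}\cdots z_n^{m_n}$ for $m\in\mathbb{Z}^n$, an orthonormal basis of $L^2(\mathbb{T}^n)$. For $m\in\mathbb{Z}^n$, $k\mid m$ means $k$ divides every component of $m$. Let $\mathcal{V}_k^n$ be the bounded linear operator on $L^2(\mathbb{T}^n)$ with $\mathcal{V}_k^n e_m=e_{-m/k}$ if $k\mid m$ and $\mathcal{V}_k^n e_m=0$ otherwise. For $\phi\in L^\infty(\mathbb{T}^n)$, $M_\phi$ is multiplication by $\phi$ and $\mathcal{S}_\phi^{k,n}=\mathcal{V}_k^nM_\phi$. The notation $\phi(z^{-k})$ means the function $z\mapsto\phi(z_1^{-k},\dots,z_n^{-k})$. *)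

theory Defs
  imports "HOL-Probability.Probability"
begin

text \<open>Normalized arc length on the unit circle, i.e. its normalized Haar measure.\<close>

definition circle_measure :: "complex measure" where
  "circle_measure =
     distr (uniform_measure lborel {0..1::real}) (restrict_space borel (sphere 0 1))
       (\<lambda>t. cis (2 * pi * t))"

text \<open>The dimension is \<open>CARD('n)\<close>.  The underlying space of this measure is exactly
  \<open>{z. \<forall>i. norm (z i) = 1}\<close>.\<close>

definition torus :: "('n::finite \<Rightarrow> complex) measure" where
  "torus = PiM UNIV (\<lambda>_. circle_measure)"

lemma measurable_cis_circle:
  "(\<lambda>t. cis (2 * pi * t))
     \<in> measurable (uniform_measure lborel {0..1::real}) (restrict_space borel (sphere 0 1))"
proof -
  have "(\<lambda>t. cis (2 * pi * t)) \<in> borel_measurable (borel :: real measure)"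
    by (intro borel_measurable_continuous_onI continuous_intros)
  then have "(\<lambda>t. cis (2 * pi * t)) \<in> borel_measurable (uniform_measure lborel {0..1::real})"
    by (simp cong: measurable_cong_sets)
  then show ?thesis
    by (intro measurable_restrict_space2) simp_all
qed

lemma space_circle_measure [simp]: "space circle_measure = sphere 0 1"
  by (simp add: circle_measure_def)

lemma sets_circle_measure: "sets circle_measure = sets (restrict_space borel (sphere 0 1))"
  by (simp add: circle_measure_def)

lemma prob_space_circle_measure: "prob_space circle_measure"
  unfolding circle_measure_def
  by (intro prob_space.prob_space_distr prob_space_uniform_measure measurable_cis_circle) simp_all

lemma prob_space_torus: "prob_space torus"
  unfolding torus_def by (intro prob_space_PiM prob_space_circle_measure)

lemma space_torus: "space torus = {z. \<forall>i. norm (z i) = 1}"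
  by (auto simp: torus_def space_PiM)

lemma measurable_torus_component [measurable]: "(\<lambda>z. z i) \<in> borel_measurable torus"
proof -
  have "(\<lambda>z. z i) \<in> measurable torus circle_measure"
    unfolding torus_def by (rule measurable_component_singleton) simp
  also have "measurable torus circle_measure
      = measurable torus (restrict_space borel (sphere 0 1) :: complex measure)"
    by (rule measurable_cong_sets) (simp_all add: sets_circle_measure)
  finally show ?thesis by (simp add: measurable_restrict_space2_iff)
qed

definition square_integrable :: "(('n::finite \<Rightarrow> complex) \<Rightarrow> complex) set" where
  "square_integrable =
     {f. f \<in> borel_measurable torus \<and> integrable torus (\<lambda>z. (norm (f z))\<^sup>2)}"

definition Linf :: "(('n::finite \<Rightarrow> complex) \<Rightarrow> complex) set" where
  "Linf = {\<phi>. \<phi> \<in> borel_measurable torus \<and> (\<exists>C. AE z in torus. norm (\<phi> z) \<le> C)}"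

lemma square_integrable_measurable [measurable_dest]:
  "f \<in> square_integrable \<Longrightarrow> f \<in> borel_measurable torus"
  by (simp add: square_integrable_def)

lemma square_integrable_zero: "(\<lambda>_. 0) \<in> square_integrable"
  by (simp add: square_integrable_def)

lemma square_integrable_add:
  assumes "f \<in> square_integrable" "g \<in> square_integrable"
  shows "(\<lambda>z. f z + g z) \<in> square_integrable"
proof -
  note [measurable] = assms[THEN square_integrable_measurable]
  have "integrable torus (\<lambda>z. 2 * (norm (f z))\<^sup>2 + 2 * (norm (g z))\<^sup>2)"
    using assms by (simp add: square_integrable_def)
  then have "integrable torus (\<lambda>z. (norm (f z + g z))\<^sup>2)"
  proof (rule Bochner_Integration.integrable_bound)
    show "AE z in torus. norm ((norm (f z + g z))\<^sup>2) \<le> norm (2 * (norm (f z))\<^sup>2 + 2 * (norm (g z))\<^sup>2)"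
    proof (rule AE_I2)
      fix z
      have "(norm (f z + g z))\<^sup>2 \<le> (norm (f z) + norm (g z))\<^sup>2"
        by (intro power_mono norm_triangle_ineq) simp
      also have "\<dots> \<le> 2 * (norm (f z))\<^sup>2 + 2 * (norm (g z))\<^sup>2"
        using sum_squares_bound[of "norm (f z)" "norm (g z)"] by (simp add: power2_sum)
      finally show "norm ((norm (f z + g z))\<^sup>2) \<le> norm (2 * (norm (f z))\<^sup>2 + 2 * (norm (g z))\<^sup>2)"
        by simp
    qed
  qed measurable
  then show ?thesis by (simp add: square_integrable_def)
qed

lemma square_integrable_Linf_mult:
  assumes "\<phi> \<in> Linf" "f \<in> square_integrable"
  shows "(\<lambda>z. \<phi> z * f z) \<in> square_integrable"
proof -
  have [measurable]: "\<phi> \<in> borel_measurable torus" "f \<in> borel_measurable torus"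
    using assms by (auto simp: Linf_def square_integrable_def)
  obtain C where C: "AE z in torus. norm (\<phi> z) \<le> C" using assms by (auto simp: Linf_def)
  have "integrable torus (\<lambda>z. C\<^sup>2 * (norm (f z))\<^sup>2)"
    using assms by (simp add: square_integrable_def)
  then have "integrable torus (\<lambda>z. (norm (\<phi> z * f z))\<^sup>2)"
  proof (rule Bochner_Integration.integrable_bound)
    show "AE z in torus. norm ((norm (\<phi> z * f z))\<^sup>2) \<le> norm (C\<^sup>2 * (norm (f z))\<^sup>2)"
      using C by eventually_elim
        (auto simp: norm_mult power_mult_distrib intro!: mult_right_mono power_mono)
  qed measurable
  then show ?thesis by (simp add: square_integrable_def)
qed

lemma Linf_const: "(\<lambda>_. c) \<in> Linf"
  by (auto simp: Linf_def)

lemma square_integrable_cmult: "f \<in> square_integrable \<Longrightarrow> (\<lambda>z. c * f z) \<in> square_integrable"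
  using square_integrable_Linf_mult[OF Linf_const] .

lemma measurable_cnj [measurable]: "cnj \<in> borel_measurable borel"
  by (intro borel_measurable_continuous_onI continuous_intros)

lemma integrable_mult_cnj:
  assumes "f \<in> square_integrable" "g \<in> square_integrable"
  shows "integrable torus (\<lambda>z. f z * cnj (g z))"
proof -
  note [measurable] = assms[THEN square_integrable_measurable]
  have "integrable torus (\<lambda>z. (norm (f z))\<^sup>2 + (norm (g z))\<^sup>2)"
    using assms by (simp add: square_integrable_def)
  then show ?thesis
  proof (rule Bochner_Integration.integrable_bound)
    show "AE z in torus. norm (f z * cnj (g z)) \<le> norm ((norm (f z))\<^sup>2 + (norm (g z))\<^sup>2)"
    proof (rule AE_I2)
      fix z
      have "0 \<le> norm (f z) * norm (g z)" by simp
      then have "norm (f z) * norm (g z) \<le> (norm (f z))\<^sup>2 + (norm (g z))\<^sup>2"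
        using sum_squares_bound[of "norm (f z)" "norm (g z)"] by linarith
      then show "norm (f z * cnj (g z)) \<le> norm ((norm (f z))\<^sup>2 + (norm (g z))\<^sup>2)"
        by (simp add: norm_mult)
    qed
  qed measurable
qed

quotient_type (overloaded) 'n L2 = "('n::finite \<Rightarrow> complex) \<Rightarrow> complex" /
  partial: "\<lambda>f g. f \<in> square_integrable \<and> g \<in> square_integrable \<and> (AE z in torus. f z = g z)"
proof (rule part_equivpI)
  show "\<exists>f::('n \<Rightarrow> complex) \<Rightarrow> complex.
      f \<in> square_integrable \<and> f \<in> square_integrable \<and> (AE z in torus. f z = f z)"
    using square_integrable_zero by auto
next
  show "symp (\<lambda>f g::('n \<Rightarrow> complex) \<Rightarrow> complex.
      f \<in> square_integrable \<and> g \<in> square_integrable \<and> (AE z in torus. f z = g z))"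
    by (auto intro!: sympI elim: eventually_mono)
next
  show "transp (\<lambda>f g::('n \<Rightarrow> complex) \<Rightarrow> complex.
      f \<in> square_integrable \<and> g \<in> square_integrable \<and> (AE z in torus. f z = g z))"
    by (rule transpI) (auto elim: eventually_elim2)
qed

text \<open>The class \<open>real_inner\<close> gives \<open>'n L2\<close> its norm; the complex structure is \<open>scaleC\<close>.
  The real inner product is the real part of the usual Hermitian one, so the norm is
  the usual one.\<close>

lift_definition scaleC :: "complex \<Rightarrow> 'n::finite L2 \<Rightarrow> 'n L2" is "\<lambda>c f z. c * f z"
  by (auto intro: square_integrable_cmult elim: eventually_mono)

instantiation L2 :: (finite) real_inner
begin

lift_definition zero_L2 :: "'a L2" is "\<lambda>_. 0"
  by (simp add: square_integrable_zero)

lift_definition plus_L2 :: "'a L2 \<Rightarrow> 'a L2 \<Rightarrow> 'a L2" is "\<lambda>f g z. f z + g z"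
  by (auto intro: square_integrable_add elim: eventually_elim2)

definition scaleR_L2 :: "real \<Rightarrow> 'a L2 \<Rightarrow> 'a L2" where
  "scaleR_L2 r f = scaleC (of_real r) f"

definition uminus_L2 :: "'a L2 \<Rightarrow> 'a L2" where
  "uminus_L2 f = scaleC (- 1) f"

definition minus_L2 :: "'a L2 \<Rightarrow> 'a L2 \<Rightarrow> 'a L2" where
  "minus_L2 f g = f + - g"

lift_definition inner_L2 :: "'a L2 \<Rightarrow> 'a L2 \<Rightarrow> real" is
  "\<lambda>f g. Re (\<integral>z. f z * cnj (g z) \<partial>torus)"
proof -
  fix f f' g g' :: "('a \<Rightarrow> complex) \<Rightarrow> complex"
  assume *: "f \<in> square_integrable \<and> f' \<in> square_integrable \<and> (AE z in torus. f z = f' z)"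
    "g \<in> square_integrable \<and> g' \<in> square_integrable \<and> (AE z in torus. g z = g' z)"
  then have [measurable]: "f \<in> borel_measurable torus" "f' \<in> borel_measurable torus"
    "g \<in> borel_measurable torus" "g' \<in> borel_measurable torus"
    by (auto simp: square_integrable_def)
  have "AE z in torus. f z = f' z" "AE z in torus. g z = g' z" using * by auto
  then have "AE z in torus. f z * cnj (g z) = f' z * cnj (g' z)" by eventually_elim simp
  then have "(\<integral>z. f z * cnj (g z) \<partial>torus) = (\<integral>z. f' z * cnj (g' z) \<partial>torus)"
    by (intro integral_cong_AE) measurable
  then show "Re (\<integral>z. f z * cnj (g z) \<partial>torus) = Re (\<integral>z. f' z * cnj (g' z) \<partial>torus)" by simp
qed

definition norm_L2 :: "'a L2 \<Rightarrow> real" where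
  "norm_L2 f = sqrt (inner f f)"

definition dist_L2 :: "'a L2 \<Rightarrow> 'a L2 \<Rightarrow> real" where
  "dist_L2 f g = norm (f - g)"

definition sgn_L2 :: "'a L2 \<Rightarrow> 'a L2" where
  "sgn_L2 f = inverse (norm f) *\<^sub>R f"

definition uniformity_L2 :: "('a L2 \<times> 'a L2) filter" where
  "uniformity_L2 = (INF e\<in>{0<..}. principal {(x, y). dist x y < e})"

definition open_L2 :: "'a L2 set \<Rightarrow> bool" where
  "open_L2 U = (\<forall>x\<in>U. \<forall>\<^sub>F (x', y) in uniformity. x' = x \<longrightarrow> y \<in> U)"

instance
proof
  fix x y z :: "'a L2" and r s :: real and U :: "'a L2 set"
  show "x + y + z = x + (y + z)"
    by transfer (auto intro!: square_integrable_add simp: add.assoc)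
  show "x + y = y + x"
    by transfer (auto intro!: square_integrable_add simp: add.commute)
  show "0 + x = x"
    by transfer auto
  show "- x + x = 0"
    unfolding uminus_L2_def
    by transfer (auto intro!: square_integrable_zero)
  show "x - y = x + - y"
    by (fact minus_L2_def)
  show "r *\<^sub>R (x + y) = r *\<^sub>R x + r *\<^sub>R y"
    unfolding scaleR_L2_def
    by transfer (auto intro!: square_integrable_add square_integrable_cmult simp: distrib_left distrib_right)
  show "(r + s) *\<^sub>R x = r *\<^sub>R x + s *\<^sub>R x"
    unfolding scaleR_L2_def
    by transfer (auto intro!: square_integrable_add square_integrable_cmult simp: distrib_left distrib_right)
  show "r *\<^sub>R s *\<^sub>R x = (r * s) *\<^sub>R x"
    unfolding scaleR_L2_def
    by transfer (auto intro!: square_integrable_cmult simp: mult.assoc)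
  show "1 *\<^sub>R x = x"
    unfolding scaleR_L2_def by transfer auto
  show "dist x y = norm (x - y)" by (fact dist_L2_def)
  show "sgn x = inverse (norm x) *\<^sub>R x" by (fact sgn_L2_def)
  show "uniformity = (INF e\<in>{0<..}. principal {(x, y::'a L2). dist x y < e})"
    by (fact uniformity_L2_def)
  show "open U = (\<forall>x\<in>U. \<forall>\<^sub>F (x', y) in uniformity. x' = x \<longrightarrow> y \<in> U)"
    by (fact open_L2_def)
  show "inner x y = inner y x"
  proof transfer
    fix x y :: "('a \<Rightarrow> complex) \<Rightarrow> complex"
    have "(\<integral>z. x z * cnj (y z) \<partial>torus) = (\<integral>z. cnj (y z * cnj (x z)) \<partial>torus)"
      by (simp add: mult.commute)
    also have "\<dots> = cnj (\<integral>z. y z * cnj (x z) \<partial>torus)" by (rule Bochner_Integration.integral_cnj)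
    finally show "Re (\<integral>z. x z * cnj (y z) \<partial>torus) = Re (\<integral>z. y z * cnj (x z) \<partial>torus)" by simp
  qed
  show "inner (x + y) z = inner x z + inner y z"
    by transfer (simp add: distrib_right integrable_mult_cnj)
  show "inner (r *\<^sub>R x) y = r * inner x y"
    unfolding scaleR_L2_def by transfer (simp add: mult.assoc)
  have eq: "Re (\<integral>z. f z * cnj (f z) \<partial>torus) = (\<integral>z. (norm (f z))\<^sup>2 \<partial>torus)"
    for f :: "('a \<Rightarrow> complex) \<Rightarrow> complex"
    by (simp add: complex_norm_square[symmetric] del: of_real_power)
  show "0 \<le> inner x x"
    by transfer (unfold eq, simp)
  show "(inner x x = 0) = (x = 0)"
  proof transfer
    fix x :: "('a \<Rightarrow> complex) \<Rightarrow> complex"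
    assume "x \<in> square_integrable \<and> x \<in> square_integrable \<and> (AE z in torus. x z = x z)"
    then have x: "x \<in> square_integrable" "integrable torus (\<lambda>z. (norm (x z))\<^sup>2)"
      by (auto simp: square_integrable_def)
    then show "(Re (\<integral>z. x z * cnj (x z) \<partial>torus) = 0) =
        (x \<in> square_integrable \<and> (\<lambda>_. 0) \<in> square_integrable \<and> (AE z in torus. x z = 0))"
      unfolding eq by (subst integral_nonneg_eq_0_iff_AE) (auto simp: square_integrable_zero)
  qed
  show "norm x = sqrt (inner x x)" by (fact norm_L2_def)
qed

end

lemma monomial_square_integrable: "(\<lambda>z. \<Prod>i\<in>UNIV. z i powi m i) \<in> square_integrable"
proof -
  interpret prob_space torus by (rule prob_space_torus)
  have 1: "(\<lambda>w::complex. w powi j) \<in> borel_measurable borel" for j :: int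
    unfolding power_int_def by measurable
  have [measurable]: "(\<lambda>z. z i powi m i) \<in> borel_measurable torus" for i
    using measurable_compose[OF measurable_torus_component 1] .
  have "integrable torus (\<lambda>z. (norm (\<Prod>i\<in>UNIV. z i powi m i))\<^sup>2)"
  proof (rule integrable_const_bound[where B = 1])
    show "AE z in torus. norm ((norm (\<Prod>i\<in>UNIV. z i powi m i))\<^sup>2) \<le> 1"
      by (rule AE_I2) (auto simp: space_torus prod_norm[symmetric] norm_power_int)
  qed measurable
  then show ?thesis by (simp add: square_integrable_def)
qed

lift_definition e_vec :: "('n::finite \<Rightarrow> int) \<Rightarrow> 'n L2" is "\<lambda>m z. \<Prod>i\<in>UNIV. z i powi m i"
  by (simp add: monomial_square_integrable)

definition bounded_clinear :: "('n::finite L2 \<Rightarrow> 'n L2) \<Rightarrow> bool" where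
  "bounded_clinear T \<longleftrightarrow> bounded_linear T \<and> (\<forall>c f. T (scaleC c f) = scaleC c (T f))"

text \<open>For \<open>k \<noteq> 0\<close> there is exactly one such operator: the \<open>e_vec m\<close> are an orthonormal basis, and
  \<open>V\<close> is the adjoint of the isometry that sends \<open>e_vec m\<close> to \<open>e_vec (\<lambda>i. - k * m i)\<close>.\<close>

definition V_op :: "int \<Rightarrow> 'n::finite L2 \<Rightarrow> 'n L2" where
  "V_op k = (THE V. bounded_clinear V \<and>
     (\<forall>m. V (e_vec m) = (if \<forall>i. k dvd m i then e_vec (\<lambda>i. - (m i div k)) else 0)))"

text \<open>Elements of \<open>L\<^sup>\<infinity>\<close> are represented by functions in \<open>Linf\<close>, taken up to equality almost
  everywhere; for symbols outside \<open>Linf\<close> the operator below is a dummy value.\<close>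

lift_definition M_op :: "(('n::finite \<Rightarrow> complex) \<Rightarrow> complex) \<Rightarrow> 'n L2 \<Rightarrow> 'n L2" is
  "\<lambda>\<phi> f. if \<phi> \<in> Linf then (\<lambda>z. \<phi> z * f z) else (\<lambda>_. 0)"
  by (auto intro: square_integrable_Linf_mult square_integrable_zero elim: eventually_mono)

definition S_op :: "int \<Rightarrow> (('n::finite \<Rightarrow> complex) \<Rightarrow> complex) \<Rightarrow> 'n L2 \<Rightarrow> 'n L2" where
  "S_op k \<phi> = V_op k \<circ> M_op \<phi>"

end

theory Submission
  imports Defs "HOL-Complex_Analysis.Cauchy_Integral_Theorem"
begin

text \<open>Let \<open>p z\<close> have the components \<open>z i powi (- k)\<close>.  The operator \<open>V_op k\<close> averages a function
  over the fibres of \<open>p\<close>; hence \<open>\<phi> \<sqdot> V f = V ((\<phi> \<circ> p) \<sqdot> f)\<close> and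
  \<open>S\<^sub>\<phi> S\<^sub>\<psi> = V V M\<^sub>\<xi>\<close> with \<open>\<xi> = (\<phi> \<circ> p) \<sqdot> \<psi>\<close>, which gives one direction at once.
  Since \<open>p\<close> and rotations preserve the measure, \<open>V\<close> preserves integrals.  Applied to
  \<open>V V M\<^sub>\<xi> e\<^sub>m\<close>, this recovers every Fourier coefficient of \<open>\<xi>\<close>, and an essentially bounded
  function is determined by these.  Measure preservation, the uniqueness of \<open>V\<close> and that last
  fact all follow from one monotone class argument, based on the Stone--Weierstrass theorem.\<close>

subsection \<open>Trigonometric polynomials and a monotone class theorem\<close>

text \<open>For \<open>k \<ge> 2\<close> the operator \<open>V = V_op k\<close> is far from
  injective: it kills every \<open>e_vec m\<close> for which some component of \<open>m\<close> is
  not divisible by \<open>k\<close>. So an equation \<open>V V M_a = V V M_b\<close> cannot be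
  cancelled directly. What survives \<open>V\<close> is the zeroth Fourier coefficient, and the
  multiplication operators make this enough: the mean of \<open>a e_m\<close> is the coefficient of
  \<open>a\<close> at \<open>-m\<close>, so varying \<open>m\<close> moves every coefficient into
  the surviving position. \<open>V_op\<close> is given only by its values on the
  \<open>e_vec m\<close>, through a definite description, while pointwise arguments need a formula.
  The solutions of \<open>z^(-k) = w\<close> form a coset of the finite group of vectors of
  \<open>k\<close>-th roots of unity. If \<open>k\<close> divides \<open>m\<close>, then
  \<open>e_m(z) = e_l(z^(-k))\<close> with \<open>l = -m/k\<close>, so \<open>e_m\<close> is
  constant on the coset; otherwise its average is a vanishing character sum. A formula in
  \<open>w\<close> needs a branch of the root, hence a discontinuous logarithm; averaging over the
  whole coset removes the choice once \<open>w\<close> is written as \<open>z^(-k)\<close>, and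
  integrals and null sets are therefore handled in the variable \<open>z\<close>.\<close>

definition torus_monomial :: "('n::finite \<Rightarrow> int) \<Rightarrow> ('n \<Rightarrow> complex) \<Rightarrow> complex" where
  "torus_monomial m z = (\<Prod>i\<in>UNIV. z i powi m i)"

lemma torus_nonzero: "z \<in> space torus \<Longrightarrow> z i \<noteq> 0"
  by (metis (mono_tags, lifting) mem_Collect_eq norm_zero space_torus zero_neq_one)

lemma torus_monomial_0 [simp]: "torus_monomial (\<lambda>_. 0) z = 1"
  by (simp add: torus_monomial_def)

lemma torus_monomial_add:
  "z \<in> space torus \<Longrightarrow> torus_monomial (\<lambda>i. m i + m' i) z = torus_monomial m z * torus_monomial m' z"
  by (simp add: torus_monomial_def power_int_add torus_nonzero prod.distrib)

lemma torus_monomial_mult: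
  "torus_monomial m (\<lambda>i. z i * w i) = torus_monomial m z * torus_monomial m w"
  by (simp add: torus_monomial_def power_int_mult_distrib prod.distrib)

lemma torus_monomial_power:
  "torus_monomial m (\<lambda>i. z i powi k) = torus_monomial (\<lambda>i. k * m i) z"
  by (simp add: torus_monomial_def power_int_mult)

lemma torus_monomial_single:
  "torus_monomial (\<lambda>j. if j = i then a else 0) z = z i powi a"
proof -
  have "torus_monomial (\<lambda>j. if j = i then a else 0) z = (\<Prod>j\<in>UNIV. if j = i then z j powi a else 1)"
    unfolding torus_monomial_def by (rule prod.cong) auto
  then show ?thesis by simp
qed

lemma norm_torus_monomial: "z \<in> space torus \<Longrightarrow> norm (torus_monomial m z) = 1"
  by (simp add: torus_monomial_def prod_norm[symmetric] norm_power_int space_torus)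

lemma measurable_torus_monomial [measurable]: "torus_monomial m \<in> borel_measurable torus"
  using monomial_square_integrable[of m, THEN square_integrable_measurable]
  by (simp add: torus_monomial_def[abs_def])

lemma continuous_on_torus_monomial: "continuous_on (space torus) (torus_monomial m)"
  unfolding torus_monomial_def[abs_def]
  by (intro continuous_on_prod continuous_on_power_int
      continuous_on_subset[OF continuous_on_product_coordinates]) (auto simp: torus_nonzero)

lemma compact_space_torus: "compact (space torus :: ('n::finite \<Rightarrow> complex) set)"
proof -
  have "compactin (product_topology (\<lambda>_. euclidean) UNIV) (PiE (UNIV :: 'n set) (\<lambda>_. sphere 0 1 :: complex set))"
    unfolding compactin_PiE by (simp add: compact_sphere)
  moreover have "PiE (UNIV :: 'n set) (\<lambda>_. sphere 0 1 :: complex set) = space torus"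
    by (auto simp: space_torus)
  ultimately show ?thesis
    by (simp add: euclidean_product_topology)
qed

inductive_set trig_poly :: "(('n::finite \<Rightarrow> complex) \<Rightarrow> complex) set" where
  monomial: "(\<lambda>z. c * torus_monomial m z) \<in> trig_poly"
| add: "f \<in> trig_poly \<Longrightarrow> g \<in> trig_poly \<Longrightarrow> (\<lambda>z. f z + g z) \<in> trig_poly"

lemma continuous_on_trig_poly: "f \<in> trig_poly \<Longrightarrow> continuous_on (space torus) f"
  by (induction rule: trig_poly.induct) (auto intro!: continuous_intros continuous_on_torus_monomial)

text \<open>Exponents of \<open>powi\<close> need not add at a zero coordinate, so the product of
  two trigonometric polynomials is matched by another one only on the torus.\<close>

lemma trig_poly_mult:
  assumes "f \<in> trig_poly" "g \<in> trig_poly"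
  shows "\<exists>h\<in>trig_poly. \<forall>z\<in>space torus. h z = f z * g z"
  using assms(1)
proof induction
  case (monomial c m)
  from assms(2) show ?case
  proof induction
    case (monomial d l)
    have "\<forall>z\<in>space torus. (c * d) * torus_monomial (\<lambda>i. m i + l i) z
        = c * torus_monomial m z * (d * torus_monomial l z)"
      by (simp add: torus_monomial_add)
    then show ?case by (metis (no_types, lifting) trig_poly.monomial)
  next
    case (add f g)
    then obtain h h' where "h \<in> trig_poly" "h' \<in> trig_poly"
      "\<forall>z\<in>space torus. h z = c * torus_monomial m z * f z"
      "\<forall>z\<in>space torus. h' z = c * torus_monomial m z * g z" by blast
    then show ?case
      by (intro bexI[of _ "\<lambda>z. h z + h' z"]) (auto simp: distrib_left intro: trig_poly.add)
  qed
next
  case (add f1 f2)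
  then obtain h h' where "h \<in> trig_poly" "h' \<in> trig_poly"
    "\<forall>z\<in>space torus. h z = f1 z * g z" "\<forall>z\<in>space torus. h' z = f2 z * g z" by blast
  then show ?case
    by (intro bexI[of _ "\<lambda>z. h z + h' z"]) (auto simp: distrib_right intro: trig_poly.add)
qed

text \<open>The real version of Stone-Weierstrass is applied to the algebra \<open>P\<close> of real
  functions that agree on the torus with a complex trigonometric polynomial.\<close>

lemma trig_poly_dense:
  fixes h :: "('n::finite \<Rightarrow> complex) \<Rightarrow> real"
  assumes "continuous_on (space torus) h" "0 < e"
  shows "\<exists>t\<in>trig_poly. \<forall>z\<in>space torus. norm (of_real (h z) - t z) < e"
proof -
  let ?K = "space torus :: ('n \<Rightarrow> complex) set"
  define P where "P = (\<lambda>g. \<exists>t\<in>trig_poly. \<forall>z\<in>?K. complex_of_real (g z) = t z)"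
  have "\<exists>g. P g \<and> (\<forall>z\<in>?K. \<bar>h z - g z\<bar> < e)"
  proof (rule Stone_Weierstrass_HOL[where P = P])
    show "compact ?K" by (rule compact_space_torus)
    show "P (\<lambda>x. c)" for c
      unfolding P_def using trig_poly.monomial[of "of_real c" "\<lambda>_. 0"]
      by (intro bexI) (auto simp del: of_real_eq_iff)
    show "continuous_on ?K g" if "P g" for g
    proof -
      obtain t where t: "t \<in> trig_poly" "\<forall>z\<in>?K. complex_of_real (g z) = t z"
        using \<open>P g\<close> unfolding P_def by blast
      have "continuous_on ?K (\<lambda>z. Re (t z))"
        by (intro continuous_intros continuous_on_trig_poly t)
      moreover have "Re (t z) = g z" if "z \<in> ?K" for z
        using t that by (metis Re_complex_of_real)
      ultimately show ?thesis by (metis (no_types, lifting) continuous_on_cong)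
    qed
    show "P (\<lambda>x. f x + g x)" if fg: "P f \<and> P g" for f g
    proof -
      obtain s t where "s \<in> trig_poly" "\<forall>z\<in>?K. complex_of_real (f z) = s z"
        "t \<in> trig_poly" "\<forall>z\<in>?K. complex_of_real (g z) = t z"
        using fg unfolding P_def by blast
      then show ?thesis
        unfolding P_def by (intro bexI[of _ "\<lambda>z. s z + t z"]) (auto intro: trig_poly.add)
    qed
    show "P (\<lambda>x. f x * g x)" if fg: "P f \<and> P g" for f g
    proof -
      obtain s t where st: "s \<in> trig_poly" "\<forall>z\<in>?K. complex_of_real (f z) = s z"
        "t \<in> trig_poly" "\<forall>z\<in>?K. complex_of_real (g z) = t z"
        using fg unfolding P_def by blast
      then obtain u where "u \<in> trig_poly" "\<forall>z\<in>?K. u z = s z * t z"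
        using trig_poly_mult[of s t] by blast
      with st show ?thesis
        unfolding P_def by (intro bexI[of _ u]) auto
    qed
    show "\<exists>f. P f \<and> f x \<noteq> f y" if xy: "x \<in> ?K \<and> y \<in> ?K \<and> x \<noteq> y" for x y
    proof -
      from xy obtain i where "x i \<noteq> y i" by (auto simp: fun_eq_iff)
      have inv: "z i powi (-1) = cnj (z i)" if "z \<in> ?K" for z
      proof -
        have "norm (z i) = 1" using that unfolding space_torus by blast
        then have "z i * cnj (z i) = 1" by (simp flip: complex_norm_square)
        then show ?thesis by (simp add: inverse_unique)
      qed
      \<comment> \<open>On the circle the inverse is the conjugate, so this real part is half the
        sum of \<open>c * z i\<close> and \<open>cnj c * z i powi (-1)\<close>. The choices
        \<open>c = 1\<close> and \<open>c = - \<i>\<close> give the real and the imaginary part of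
        the coordinate, which together separate points.\<close>
      have P_coordinate: "P (\<lambda>z. Re (c * z i))" for c
      proof -
        define t where "t z = c / 2 * torus_monomial (\<lambda>j. if j = i then 1 else 0) z
          + cnj c / 2 * torus_monomial (\<lambda>j. if j = i then -1 else 0) z" for z
        have "t \<in> trig_poly"
          unfolding t_def by (intro trig_poly.intros)
        moreover have "complex_of_real (Re (c * z i)) = t z" if "z \<in> ?K" for z
          unfolding t_def torus_monomial_single inv[OF that] by (simp add: complex_eq_iff add_divide_distrib diff_divide_distrib)
        ultimately show ?thesis unfolding P_def by blast
      qed
      have "Re (x i) \<noteq> Re (y i) \<or> Re (- \<i> * x i) \<noteq> Re (- \<i> * y i)"
        using \<open>x i \<noteq> y i\<close> by (auto simp: complex_eq_iff)
      then show ?thesis using P_coordinate[of 1] P_coordinate[of "-\<i>"] by auto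
    qed
  qed (use assms in auto)
  then obtain g t where "t \<in> trig_poly" "\<forall>z\<in>?K. complex_of_real (g z) = t z"
    "\<forall>z\<in>?K. \<bar>h z - g z\<bar> < e" unfolding P_def by blast
  then show ?thesis
    by (metis norm_of_real of_real_diff)
qed

section \<open>The sigma-algebra of the torus, generated by closed boxes\<close>

lemma measurable_torusI:
  assumes "\<And>i. (\<lambda>x. f x i) \<in> borel_measurable N"
    and "\<And>x i. x \<in> space N \<Longrightarrow> norm (f x i) = 1"
  shows "f \<in> measurable N torus"
proof -
  have "(\<lambda>x. f x i) \<in> measurable N circle_measure" for i
  proof -
    have "(\<lambda>x. f x i) \<in> measurable N (restrict_space borel (sphere 0 1))"
    proof (rule measurable_restrict_space2)
      show "(\<lambda>x. f x i) \<in> space N \<rightarrow> sphere 0 1" by (rule funcsetI) (simp add: assms(2))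
    qed (rule assms(1))
    then show ?thesis
      unfolding measurable_cong_sets[OF refl sets_circle_measure] .
  qed
  then have "(\<lambda>x i. f x i) \<in> measurable N torus"
    unfolding torus_def
    by (rule measurable_PiM_single') (auto simp: assms(2))
  then show ?thesis by simp
qed

text \<open>Closed factors make these sets a generator that is stable under intersection and whose
  indicators are pointwise limits of continuous functions.\<close>

definition closed_boxes :: "('n::finite \<Rightarrow> complex) set set" where
  "closed_boxes = {B. \<exists>C. (\<forall>i. closed (C i)) \<and> B = {z \<in> space torus. \<forall>i. z i \<in> C i}}"

lemma closed_boxes_subset: "closed_boxes \<subseteq> Pow (space torus)"
  by (auto simp: closed_boxes_def)

lemma sets_torus_eq_closed_boxes:
  "sets torus = sigma_sets (space torus) closed_boxes"
proof
  let ?N = "sigma (space torus) closed_boxes :: ('a \<Rightarrow> complex) measure"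
  note sub = closed_boxes_subset[where 'a = 'a]
  show "sets torus \<subseteq> sigma_sets (space (torus :: ('a \<Rightarrow> complex) measure)) closed_boxes"
  proof
    fix A :: "('a \<Rightarrow> complex) set" assume A: "A \<in> sets torus"
    \<comment> \<open>Measurability of the identity into \<open>torus\<close> is the required
      inclusion of sigma-algebras; it only has to be checked coordinatewise and on closed sets,
      whose preimages are boxes with a single constrained coordinate.\<close>
    have "(\<lambda>z. z) \<in> measurable ?N torus"
    proof (rule measurable_torusI)
      show "(\<lambda>z. z i) \<in> borel_measurable ?N" for i
        unfolding borel_eq_closed
      proof (rule measurable_measure_of)
        fix C :: "complex set" assume "C \<in> Collect closed"
        then have "(\<lambda>z. z i) -` C \<inter> space torus \<in> closed_boxes"
          unfolding closed_boxes_def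
          by (intro CollectI exI[of _ "\<lambda>j. if j = i then C else UNIV"]) auto
        then show "(\<lambda>z. z i) -` C \<inter> space ?N \<in> sets ?N"
          using sub by (auto simp: space_measure_of_conv)
      qed auto
    qed (auto simp: space_torus space_measure_of_conv)
    from measurable_sets[OF this A] have "A \<inter> space torus \<in> sets ?N"
      by (simp add: space_measure_of_conv)
    then show "A \<in> sigma_sets (space torus) closed_boxes"
      using sub sets.sets_into_space[OF A] by (simp add: Int_absorb2)
  qed
  show "sigma_sets (space (torus :: ('a \<Rightarrow> complex) measure)) closed_boxes \<subseteq> sets torus"
  proof (rule sets.sigma_sets_subset, rule subsetI)
    fix B :: "('a \<Rightarrow> complex) set" assume "B \<in> closed_boxes"
    then obtain C where C: "\<And>i. closed (C i)" "B = {z \<in> space torus. \<forall>i. z i \<in> C i}"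
      unfolding closed_boxes_def by blast
    have [measurable]: "C i \<in> sets borel" for i using C by simp
    show "B \<in> sets torus" unfolding C(2) by measurable
  qed
qed

lemma Int_stable_closed_boxes: "Int_stable closed_boxes"
proof (rule Int_stableI)
  fix A B :: "('a \<Rightarrow> complex) set" assume "A \<in> closed_boxes" "B \<in> closed_boxes"
  then obtain C D where "\<And>i. closed (C i)" "A = {z \<in> space torus. \<forall>i. z i \<in> C i}"
    "\<And>i. closed (D i)" "B = {z \<in> space torus. \<forall>i. z i \<in> D i}"
    unfolding closed_boxes_def by blast
  then show "A \<inter> B \<in> closed_boxes"
    unfolding closed_boxes_def by (intro CollectI exI[of _ "\<lambda>i. C i \<inter> D i"]) auto
qed

text \<open>Each factor is a ramp that equals 1 on \<open>C i\<close> and drops to 0 at distance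
  \<open>1 / j\<close>. For a point outside the box, one factor with positive distance is eventually
  0 and annihilates the product.\<close>

lemma closed_box_indicator_limit:
  fixes C :: "'n::finite \<Rightarrow> complex set"
  assumes "\<And>i. closed (C i)" "\<And>i. C i \<noteq> {}"
  shows "(\<lambda>j. \<Prod>i\<in>UNIV. max 0 (1 - real j * infdist (z i) (C i)))
    \<longlonglongrightarrow> (if \<forall>i. z i \<in> C i then 1 else 0)"
proof (cases "\<forall>i. z i \<in> C i")
  case True
  then have "infdist (z i) (C i) = 0" for i by simp
  with True show ?thesis by simp
next
  case False
  then obtain i where i: "z i \<notin> C i" by blast
  then have pos: "infdist (z i) (C i) > 0"
    using assms by (simp add: infdist_pos_not_in_closed)
  have "\<forall>\<^sub>F j in sequentially. 1 / infdist (z i) (C i) \<le> real j"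
    using filterlim_real_sequentially by (auto simp: filterlim_at_top)
  then have "\<forall>\<^sub>F j in sequentially. (\<Prod>i\<in>UNIV. max 0 (1 - real j * infdist (z i) (C i))) = 0"
  proof eventually_elim
    case (elim j)
    with pos have "max 0 (1 - real j * infdist (z i) (C i)) = 0" by (simp add: field_simps)
    then show ?case by (metis UNIV_I finite prod_zero_iff)
  qed
  with False show ?thesis by (auto intro: tendsto_eventually)
qed

text \<open>The hypotheses of the monotone class argument. It is instantiated with functions whose
  integral is unchanged by a map, functions annihilated by a symbol, and functions whose class lies
  in a closed subspace of \<open>L2\<close>. Measurability and a common bound are premises of
  \<open>lim\<close>, so that dominated convergence proves it in each instance.\<close>

locale torus_function_class =
  fixes H :: "(('n::finite \<Rightarrow> complex) \<Rightarrow> complex) set"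
  assumes monomial: "torus_monomial m \<in> H"
    and add: "f \<in> H \<Longrightarrow> g \<in> H \<Longrightarrow> (\<lambda>z. f z + g z) \<in> H"
    and cmult: "f \<in> H \<Longrightarrow> (\<lambda>z. c * f z) \<in> H"
    and lim: "\<And>s f B. (\<And>j::nat. s j \<in> H) \<Longrightarrow> (\<And>j. s j \<in> borel_measurable torus) \<Longrightarrow>
      f \<in> borel_measurable torus \<Longrightarrow>
      (\<And>j z. z \<in> space torus \<Longrightarrow> norm (s j z) \<le> B) \<Longrightarrow>
      (\<And>z. z \<in> space torus \<Longrightarrow> (\<lambda>j. s j z) \<longlonglongrightarrow> f z) \<Longrightarrow> f \<in> H"
begin

lemma const: "(\<lambda>_. c) \<in> H"
  using cmult[OF monomial[of "\<lambda>_. 0"], of c] by simp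

lemma sum: "finite I \<Longrightarrow> (\<And>i. i \<in> I \<Longrightarrow> f i \<in> H) \<Longrightarrow> (\<lambda>z. \<Sum>i\<in>I. f i z) \<in> H"
  by (induction rule: finite_induct) (auto intro: const add)

lemma trig_poly: "f \<in> trig_poly \<Longrightarrow> f \<in> H \<and> f \<in> borel_measurable torus"
  by (induction rule: trig_poly.induct) (auto intro: add cmult monomial)

text \<open>The limit axiom only looks at points of the torus, so a constant sequence allows the
  values elsewhere to be changed.\<close>

lemma cong:
  assumes "f \<in> H" "f \<in> borel_measurable torus" "\<And>z. z \<in> space torus \<Longrightarrow> norm (f z) \<le> B"
    and "\<And>z. z \<in> space torus \<Longrightarrow> f z = g z"
  shows "g \<in> H"
proof (rule lim[of "\<lambda>_. f" _ B])
  show "g \<in> borel_measurable torus" using assms(2,4) by (simp cong: measurable_cong)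
qed (use assms in auto)

lemma continuous_real:
  fixes h :: "('n \<Rightarrow> complex) \<Rightarrow> real"
  assumes h: "continuous_on (space torus) h" "h \<in> borel_measurable torus"
    and B: "\<And>z. z \<in> space torus \<Longrightarrow> \<bar>h z\<bar> \<le> B"
  shows "(\<lambda>z. of_real (h z)) \<in> H"
proof -
  have "\<exists>t\<in>trig_poly. \<forall>z\<in>space torus. norm (of_real (h z) - t z) < 1 / real (Suc j)" for j
    using h(1) by (intro trig_poly_dense) auto
  then obtain t where t: "\<And>j. t j \<in> trig_poly"
    "\<And>j z. z \<in> space torus \<Longrightarrow> norm (of_real (h z) - t j z) < 1 / real (Suc j)"
    by metis
  show ?thesis
  proof (rule lim[of t _ "B + 1"])
    fix z :: "'n \<Rightarrow> complex" and j :: nat assume z: "z \<in> space torus"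
    have "norm (of_real (h z) - t j z) < 1"
      using t(2)[OF z, of j] by (rule less_le_trans) simp
    \<comment> \<open>All errors are at most 1, so the uniform approximations share one bound, as
      \<open>lim\<close> demands.\<close>
    then show "norm (t j z) \<le> B + 1"
      using B[OF z] norm_triangle_ineq3[of "of_real (h z)" "t j z"] by simp
    have "(\<lambda>j. of_real (h z) - t j z) \<longlonglongrightarrow> 0"
      by (rule Lim_null_comparison[OF _ LIMSEQ_inverse_real_of_nat])
        (use t(2)[OF z] in \<open>auto simp: inverse_eq_divide less_imp_le intro!: always_eventually\<close>)
    from tendsto_diff[OF tendsto_const[of "of_real (h z)"] this]
    show "(\<lambda>j. t j z) \<longlonglongrightarrow> of_real (h z)" by simp
  qed (use t(1) trig_poly h(2) in auto)
qed

lemma closed_box: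
  assumes "A \<in> closed_boxes"
  shows "indicator A \<in> H"
proof -
  obtain C where C: "\<And>i. closed (C i)" "A = {z \<in> space torus. \<forall>i. z i \<in> C i}"
    using assms unfolding closed_boxes_def by blast
  show ?thesis
  proof (cases "\<exists>i. C i = {}")
    case True
    \<comment> \<open>An empty factor is treated apart: \<open>infdist\<close> to the empty set is
      0, which would make its ramp constantly 1.\<close>
    then have "A = {}" using C(2) by auto
    then show ?thesis using const[of 0] by (simp add: indicator_def[abs_def])
  next
    case False
    then have ne: "C i \<noteq> {}" for i by blast
    define g where "g j z = (\<Prod>i\<in>UNIV. max 0 (1 - real j * infdist (z i) (C i)))" for j z
    have g01: "0 \<le> g j z" "g j z \<le> 1" for j z
      unfolding g_def by (intro prod_nonneg prod_le_1; simp add: infdist_nonneg)+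
    have g_meas [measurable]: "g j \<in> borel_measurable torus" for j
    proof -
      have [measurable]: "(\<lambda>w. infdist w (C i)) \<in> borel_measurable borel" for i
        by (intro borel_measurable_continuous_onI continuous_intros)
      show ?thesis unfolding g_def by measurable
    qed
    have gH: "(\<lambda>z. of_real (g j z)) \<in> H" for j
    proof (rule continuous_real[where B = 1])
      show "continuous_on (space torus) (g j)"
        unfolding g_def
        by (intro continuous_intros continuous_on_subset[OF continuous_on_product_coordinates]) auto
      show "\<bar>g j z\<bar> \<le> 1" for z using g01[of j z] by simp
    qed measurable
    have A: "A \<in> sets torus"
      using assms by (simp add: sets_torus_eq_closed_boxes sigma_sets.Basic)
    show ?thesis
    proof (rule lim[of "\<lambda>j z. of_real (g j z)" _ 1])
      fix z :: "'n \<Rightarrow> complex" assume z: "z \<in> space torus"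
      have "(\<lambda>j. complex_of_real (g j z)) \<longlonglongrightarrow> of_real (if \<forall>i. z i \<in> C i then 1 else 0)"
        unfolding g_def by (intro tendsto_of_real closed_box_indicator_limit C(1) ne)
      also have "of_real (if \<forall>i. z i \<in> C i then 1 else 0) = indicator A z"
        using z C(2) by (simp add: indicator_def)
      finally show "(\<lambda>j. complex_of_real (g j z)) \<longlonglongrightarrow> indicator A z" .
      show "norm (complex_of_real (g j z)) \<le> 1" for j using g01[of j z] by simp
    qed (use gH A in simp_all)
  qed
qed

text \<open>Dynkin's pi-lambda argument. In the union case disjointness turns the partial sums into
  indicators, so they stay bounded by 1.\<close>

lemma indicator_in:
  assumes "A \<in> sets torus"
  shows "indicator A \<in> H"
proof -
  have "A \<in> sigma_sets (space torus) closed_boxes"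
    using assms by (simp add: sets_torus_eq_closed_boxes)
  with Int_stable_closed_boxes closed_boxes_subset show ?thesis
  proof (induction rule: sigma_sets_induct_disjoint)
    case (compl A)
    then have A: "A \<in> sets torus" by (simp add: sets_torus_eq_closed_boxes)
    have "(\<lambda>z. 1 + (-1) * indicator A z) \<in> H" by (intro add cmult const compl)
    then show ?case
      by (rule cong[where B = 1]) (use A in \<open>auto split: split_indicator\<close>)
  next
    case (union A)
    then have A: "\<And>i. A i \<in> sets torus" by (auto simp: sets_torus_eq_closed_boxes)
    have eq: "(\<Sum>i<j. indicator (A i) z) = (indicator (\<Union>i<j. A i) z :: complex)" for j z
      using union(1) by (subst indicator_UN_disjoint) (auto simp: disjoint_family_on_def)
    show ?case
    proof (rule lim[of "\<lambda>j z. \<Sum>i<j. indicator (A i) z" _ 1])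
      show "(\<lambda>j. \<Sum>i<j. indicator (A i) z) \<longlonglongrightarrow> (indicator (\<Union>i. A i) z :: complex)" for z
        unfolding eq by (rule LIMSEQ_indicator_UN)
      show "norm (\<Sum>i<j. indicator (A i) z :: complex) \<le> 1" for j z
        unfolding eq by (auto split: split_indicator)
    qed (use A union in \<open>auto intro!: sum\<close>)
  next
    case empty
    show ?case using const[of 0] by (simp add: indicator_def[abs_def])
  qed (rule closed_box)
qed

theorem bounded_measurable:
  assumes f: "f \<in> borel_measurable torus" and B: "\<And>z. z \<in> space torus \<Longrightarrow> norm (f z) \<le> B"
  shows "f \<in> H"
proof -
  \<comment> \<open>The base point 0 turns the distance estimate into
    \<open>norm (s j z) \<le> 2 * norm (f z)\<close>, which supplies the common bound
    \<open>2 * B\<close>.\<close>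
  from borel_measurable_implies_sequence_metric[OF f, of 0]
  obtain s where "(\<forall>j. simple_function torus (s j)) \<and> (\<forall>z\<in>space torus. (\<lambda>j. s j z) \<longlonglongrightarrow> f z) \<and>
      (\<forall>j. \<forall>z\<in>space torus. dist (s j z) 0 \<le> 2 * dist (f z) 0)" ..
  then have s: "\<And>j. simple_function torus (s j)"
    "\<And>z. z \<in> space torus \<Longrightarrow> (\<lambda>j. s j z) \<longlonglongrightarrow> f z"
    "\<And>j z. z \<in> space torus \<Longrightarrow> norm (s j z) \<le> 2 * norm (f z)"
    by simp_all
  have bound: "norm (s j z) \<le> 2 * B" if "z \<in> space torus" for j z
    using s(3)[OF that, of j] B[OF that] by simp
  have "s j \<in> H" for j
  proof -
    let ?g = "\<lambda>z. \<Sum>y \<in> s j ` space torus. y * indicator (s j -` {y} \<inter> space torus) z"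
    have eq: "?g z = s j z" if "z \<in> space torus" for z
      by (rule trans[OF _ simple_function_indicator_representation_banach[OF s(1) that, symmetric]])
        (auto intro!: sum.cong split: split_indicator)
    have sets: "s j -` {y} \<inter> space torus \<in> sets torus" for y
      by (rule simple_functionD(2)[OF s(1)])
    have "?g \<in> H"
      by (intro sum cmult indicator_in sets simple_functionD(1)[OF s(1)])
    then show ?thesis
    proof (rule cong[where B = "2 * B"])
      show "?g \<in> borel_measurable torus"
        by (intro borel_measurable_sum borel_measurable_times borel_measurable_indicator sets) simp
      show "norm (?g z) \<le> 2 * B" if "z \<in> space torus" for z
        unfolding eq[OF that] by (rule bound[OF that])
    qed (rule eq)
  qed
  then show ?thesis
    by (rule lim[OF _ borel_measurable_simple_function[OF s(1)] f bound s(2)])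
qed

end

subsection \<open>Fourier coefficients and measure preserving maps\<close>

text \<open>For \<open>a \<noteq> 0\<close> the antiderivative of
  \<open>cis (2 * pi * a * t)\<close>, namely the same function divided by
  \<open>2 * pi * a * \<i>\<close>, takes equal values at 0 and 1.\<close>

lemma integral_circle_powi:
  "(\<integral>z. z powi a \<partial>circle_measure) = (if a = 0 then 1 else 0)"
proof (cases "a = 0")
  case True
  then show ?thesis
    using prob_space.prob_space[OF prob_space_circle_measure] by simp
next
  case False
  have [measurable]: "(\<lambda>z::complex. z powi a) \<in> borel_measurable borel"
    unfolding power_int_def by measurable
  have meas: "(\<lambda>z::complex. z powi a) \<in> borel_measurable (restrict_space borel (sphere 0 1))"
    by (rule measurable_restrict_space1) measurable
  have [measurable]: "(\<lambda>t. cis (2 * pi * t)) \<in> borel_measurable borel"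
    by (intro borel_measurable_continuous_onI continuous_intros)
  let ?f = "\<lambda>t::real. cis (2 * pi * of_int a * t)"
  have powi: "cis (2 * pi * t) powi a = ?f t" for t
    by (simp add: cis_power_int mult_ac)
  have "(\<integral>z. z powi a \<partial>circle_measure) = (\<integral>t. ?f t \<partial>uniform_measure lborel {0..1})"
    unfolding circle_measure_def integral_distr[OF measurable_cis_circle meas] powi ..
  also have "\<dots> = (\<integral>t. indicator {0..1} t *\<^sub>R ?f t \<partial>lborel)"
  proof -
    have *: "uniform_measure lborel {0..1::real} = density lborel (\<lambda>t. ennreal (indicator {0..1} t))"
      unfolding uniform_measure_def by (simp add: ennreal_indicator divide_ennreal_def)
    have "?f \<in> borel_measurable lborel"
      by (simp, intro borel_measurable_continuous_onI continuous_intros)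
    then show ?thesis
      unfolding * by (intro integral_density) auto
  qed
  also have "\<dots> = ?f 1 / (2 * pi * of_int a * \<i>) - ?f 0 / (2 * pi * of_int a * \<i>)"
  proof (rule integral_FTC_Icc)
    fix t :: real
    have "((\<lambda>t. exp (\<i> * of_real (2 * pi * of_int a * t)) / (2 * pi * of_int a * \<i>)) has_vector_derivative
      exp (\<i> * of_real (2 * pi * of_int a * t))) (at t within {0..1})"
      using False by (auto intro!: derivative_eq_intros has_vector_derivative_real_field simp: field_simps)
    then show "((\<lambda>t. ?f t / (2 * pi * of_int a * \<i>)) has_vector_derivative ?f t) (at t within {0..1})"
      by (simp add: cis_conv_exp)
  qed (auto intro!: continuous_intros)
  also have "?f 1 = 1"
    by (metis cis_multiple_2pi Ints_of_int mult.commute mult.right_neutral mult.left_commute)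
  finally show ?thesis using False by simp
qed

lemma integral_torus_monomial:
  "(\<integral>z. torus_monomial m z \<partial>torus) = (if m = (\<lambda>_. 0) then 1 else 0)"
proof -
  interpret product_sigma_finite "\<lambda>_::'a. circle_measure"
    by (simp add: product_sigma_finite_def prob_space_circle_measure prob_space_imp_sigma_finite)
  interpret C: prob_space circle_measure by (rule prob_space_circle_measure)
  have "integrable circle_measure (\<lambda>z. z powi a)" for a
  proof (rule C.integrable_const_bound[where B = 1])
    have "(\<lambda>z::complex. z powi a) \<in> borel_measurable borel"
      unfolding power_int_def by measurable
    then have "(\<lambda>z::complex. z powi a) \<in> borel_measurable (restrict_space borel (sphere 0 1))"
      by (rule measurable_restrict_space1)
    then show "(\<lambda>z. z powi a) \<in> borel_measurable circle_measure"
      unfolding measurable_cong_sets[OF sets_circle_measure refl] .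
  qed (auto intro!: AE_I2 simp: norm_power_int)
  then have "(\<integral>z. torus_monomial m z \<partial>torus) = (\<Prod>i\<in>UNIV. \<integral>z. z powi m i \<partial>circle_measure)"
    unfolding torus_def torus_monomial_def by (intro product_integral_prod) auto
  also have "\<dots> = (if m = (\<lambda>_. 0) then 1 else 0)"
    unfolding integral_circle_powi by (auto simp: fun_eq_iff)
  finally show ?thesis .
qed

text \<open>A measure on the torus is determined by its Fourier coefficients: agreement of the
  integrals passes from monomials to indicators by the monotone class theorem.\<close>

lemma torus_measure_preservingI:
  fixes T :: "('n::finite \<Rightarrow> complex) \<Rightarrow> 'n \<Rightarrow> complex"
  assumes T [measurable]: "T \<in> measurable torus torus"
    and eq: "\<And>m. (\<integral>z. torus_monomial m (T z) \<partial>torus) = (\<integral>z. torus_monomial m z \<partial>torus)"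
  shows "distr torus torus T = torus"
proof -
  interpret prob_space "torus :: ('n \<Rightarrow> complex) measure" by (rule prob_space_torus)
  interpret D: prob_space "distr torus torus T" by (rule prob_space_distr) fact
  \<comment> \<open>Boundedness belongs to the class because it makes both integrals exist, and
    additivity of the integral relies on that.\<close>
  let ?H = "{f. f \<in> borel_measurable torus \<and> (\<exists>B. \<forall>z\<in>space torus. norm (f z) \<le> B) \<and>
    (\<integral>z. f (T z) \<partial>torus) = (\<integral>z. f z \<partial>torus)}"
  have T_space: "T z \<in> space torus" if "z \<in> space torus" for z
    using measurable_space[OF T that] .
  have int: "integrable torus f" "integrable torus (\<lambda>z. f (T z))"
    if [measurable]: "f \<in> borel_measurable torus" and B: "\<forall>z\<in>space torus. norm (f z) \<le> B"
    for f :: "('n \<Rightarrow> complex) \<Rightarrow> complex" and B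
    by (rule integrable_const_bound[where B = B]; (rule AE_I2)?; use B T_space in simp)+
  interpret torus_function_class ?H
  proof
    fix f g :: "('n \<Rightarrow> complex) \<Rightarrow> complex" assume "f \<in> ?H" "g \<in> ?H"
    then obtain A B where [measurable]: "f \<in> borel_measurable torus" "g \<in> borel_measurable torus"
      and fg: "\<forall>z\<in>space torus. norm (f z) \<le> A" "\<forall>z\<in>space torus. norm (g z) \<le> B"
        "(\<integral>z. f (T z) \<partial>torus) = (\<integral>z. f z \<partial>torus)" "(\<integral>z. g (T z) \<partial>torus) = (\<integral>z. g z \<partial>torus)"
      by blast
    have "norm (f z + g z) \<le> A + B" if "z \<in> space torus" for z
      by (rule norm_triangle_mono) (use that fg(1,2) in blast)+
    moreover have "(\<integral>z. f (T z) + g (T z) \<partial>torus) = (\<integral>z. f z + g z \<partial>torus)"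
      unfolding Bochner_Integration.integral_add[OF int(1)[OF _ fg(1)] int(1)[OF _ fg(2)], simplified]
        Bochner_Integration.integral_add[OF int(2)[OF _ fg(1)] int(2)[OF _ fg(2)], simplified] fg(3,4) ..
    moreover have "(\<lambda>z. f z + g z) \<in> borel_measurable torus" by measurable
    ultimately show "(\<lambda>z. f z + g z) \<in> ?H" by blast
  next
    fix f :: "('n \<Rightarrow> complex) \<Rightarrow> complex" and c assume "f \<in> ?H"
    then obtain B where [measurable]: "f \<in> borel_measurable torus"
      and f: "\<forall>z\<in>space torus. norm (f z) \<le> B" "(\<integral>z. f (T z) \<partial>torus) = (\<integral>z. f z \<partial>torus)"
      by blast
    have "norm (c * f z) \<le> norm c * B" if "z \<in> space torus" for z
      unfolding norm_mult by (rule mult_left_mono) (use that f(1) in auto)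
    moreover have "(\<integral>z. c * f (T z) \<partial>torus) = (\<integral>z. c * f z \<partial>torus)"
      using f(2) by simp
    moreover have "(\<lambda>z. c * f z) \<in> borel_measurable torus" by measurable
    ultimately show "(\<lambda>z. c * f z) \<in> ?H" by blast
  next
    fix s :: "nat \<Rightarrow> ('n \<Rightarrow> complex) \<Rightarrow> complex" and f B
    assume H: "\<And>j. s j \<in> ?H" and s [measurable]: "\<And>j. s j \<in> borel_measurable torus"
      and f [measurable]: "f \<in> borel_measurable torus"
      and B: "\<And>j z. z \<in> space torus \<Longrightarrow> norm (s j z) \<le> B"
      and lim: "\<And>z. z \<in> space torus \<Longrightarrow> (\<lambda>j. s j z) \<longlonglongrightarrow> f z"
    have "(\<lambda>j. \<integral>z. s j z \<partial>torus) \<longlonglongrightarrow> (\<integral>z. f z \<partial>torus)"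
      by (rule integral_dominated_convergence[where w = "\<lambda>_. B"]) (auto intro!: AE_I2 B lim)
    moreover have "(\<lambda>j. \<integral>z. s j (T z) \<partial>torus) \<longlonglongrightarrow> (\<integral>z. f (T z) \<partial>torus)"
      by (rule integral_dominated_convergence[where w = "\<lambda>_. B"]) (auto intro!: AE_I2 B lim T_space)
    moreover have "(\<integral>z. s j (T z) \<partial>torus) = (\<integral>z. s j z \<partial>torus)" for j
      using H by blast
    ultimately have "(\<integral>z. f (T z) \<partial>torus) = (\<integral>z. f z \<partial>torus)"
      by (auto intro: LIMSEQ_unique)
    moreover have "norm (f z) \<le> B" if "z \<in> space torus" for z
      by (rule LIMSEQ_le_const2[OF tendsto_norm[OF lim[OF that]]]) (use B[OF that] in blast)
    ultimately show "f \<in> ?H" using f by blast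
  qed (auto simp: eq norm_torus_monomial intro!: exI[of _ 1])
  show ?thesis
  proof (rule measure_eqI)
    fix A assume "A \<in> sets (distr torus torus T)"
    then have A [measurable]: "A \<in> sets torus" by simp
    have "(indicator A :: _ \<Rightarrow> complex) \<in> ?H" by (rule indicator_in[OF A])
    then have "(\<integral>z. complex_of_real (indicator A (T z)) \<partial>torus)
        = (\<integral>z. complex_of_real (indicator A z) \<partial>torus)"
      by (simp add: of_real_indicator)
    then have "(\<integral>z. indicat_real A (T z) \<partial>torus) = (\<integral>z. indicat_real A z \<partial>torus)"
      unfolding integral_complex_of_real of_real_eq_iff .
    then have "(\<integral>z. indicat_real A z \<partial>distr torus torus T) = (\<integral>z. indicat_real A z \<partial>torus)"
      by (subst integral_distr) auto
    then have "D.prob A = prob A"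
      using A by (simp add: Int_absorb2 sets.sets_into_space)
    then show "emeasure (distr torus torus T) A = emeasure torus A"
      by (simp add: emeasure_eq_measure D.emeasure_eq_measure)
  qed simp
qed

lemma measurable_torus_rotation [measurable]:
  assumes "u \<in> space torus"
  shows "(\<lambda>z i. u i * z i) \<in> measurable torus torus"
  using assms by (intro measurable_torusI) (auto simp: space_torus norm_mult)

text \<open>Rotation multiplies a monomial by the constant \<open>torus_monomial m u\<close>. This
  is 1 for \<open>m = 0\<close>, and for every other \<open>m\<close> both integrals are 0.\<close>

lemma distr_torus_rotation:
  assumes "u \<in> space torus"
  shows "distr torus torus (\<lambda>z i. u i * z i) = torus"
  using assms
  by (intro torus_measure_preservingI measurable_torus_rotation)
    (auto simp: torus_monomial_mult integral_torus_monomial)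

lemma measurable_torus_power [measurable]: "(\<lambda>z i. z i powi k) \<in> measurable torus torus"
proof (rule measurable_torusI)
  have [measurable]: "(\<lambda>z::complex. z powi k) \<in> borel_measurable borel"
    unfolding power_int_def by measurable
  show "(\<lambda>z. z i powi k) \<in> borel_measurable torus" for i by measurable
qed (simp add: space_torus norm_power_int)

text \<open>The power map replaces \<open>m\<close> by \<open>k * m\<close>, which vanishes exactly
  when \<open>m\<close> does.\<close>

lemma distr_torus_power:
  assumes "k \<noteq> 0"
  shows "distr torus torus (\<lambda>z i. z i powi k) = torus"
  using assms
  by (intro torus_measure_preservingI measurable_torus_power)
    (auto simp: torus_monomial_power integral_torus_monomial fun_eq_iff)

text \<open>Orthogonality to the monomials extends to all bounded measurable functions; testing
  against the conjugate of \<xi> then gives a vanishing integral of the squared modulus. The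
  monomials carry no conjugate, which only replaces \<open>m\<close> by \<open>-m\<close>.\<close>

lemma Linf_eq_0_AE:
  assumes \<xi>: "\<xi> \<in> Linf" and coeff: "\<And>m. (\<integral>z. \<xi> z * torus_monomial m z \<partial>torus) = 0"
  shows "AE z in torus. \<xi> z = 0"
proof -
  interpret prob_space "torus :: ('a \<Rightarrow> complex) measure" by (rule prob_space_torus)
  have [measurable]: "\<xi> \<in> borel_measurable torus" using \<xi> by (simp add: Linf_def)
  obtain C where C: "AE z in torus. norm (\<xi> z) \<le> C" using \<xi> by (auto simp: Linf_def)
  have dom: "AE z in torus. norm (\<xi> z * f z) \<le> C * B"
    if "\<And>z. z \<in> space torus \<Longrightarrow> norm (f z) \<le> B" for f :: "_ \<Rightarrow> complex" and B
    using C AE_space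
  proof eventually_elim
    case (elim z)
    then show ?case unfolding norm_mult
      by (intro mult_mono that order_trans[OF norm_ge_zero elim(1)]) auto
  qed
  let ?H = "{f. f \<in> borel_measurable torus \<and> integrable torus (\<lambda>z. \<xi> z * f z) \<and> (\<integral>z. \<xi> z * f z \<partial>torus) = 0}"
  interpret torus_function_class ?H
  proof
    have "integrable torus (\<lambda>z. \<xi> z * torus_monomial m z)" for m
      by (rule integrable_const_bound[OF dom[of _ 1]]) (auto simp: norm_torus_monomial)
    then show "torus_monomial m \<in> ?H" for m using coeff by auto
  next
    fix s :: "nat \<Rightarrow> ('a \<Rightarrow> complex) \<Rightarrow> complex" and f B
    assume H: "\<And>j. s j \<in> ?H" and s [measurable]: "\<And>j. s j \<in> borel_measurable torus"
      and f [measurable]: "f \<in> borel_measurable torus"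
      and B: "\<And>j z. z \<in> space torus \<Longrightarrow> norm (s j z) \<le> B"
      and lim: "\<And>z. z \<in> space torus \<Longrightarrow> (\<lambda>j. s j z) \<longlonglongrightarrow> f z"
    have ae: "AE z in torus. (\<lambda>j. \<xi> z * s j z) \<longlonglongrightarrow> \<xi> z * f z"
      by (intro AE_I2 tendsto_intros lim)
    have m: "(\<lambda>z. \<xi> z * f z) \<in> borel_measurable torus" "\<And>j. (\<lambda>z. \<xi> z * s j z) \<in> borel_measurable torus"
      by measurable
    note dc = m _ ae dom[OF B]
    have "integrable torus (\<lambda>z. \<xi> z * f z)"
      by (rule integrable_dominated_convergence[OF dc]) auto
    moreover have "(\<lambda>j. \<integral>z. \<xi> z * s j z \<partial>torus) \<longlonglongrightarrow> (\<integral>z. \<xi> z * f z \<partial>torus)"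
      by (rule integral_dominated_convergence[OF dc]) auto
    moreover have "(\<integral>z. \<xi> z * s j z \<partial>torus) = 0" for j using H by blast
    ultimately show "f \<in> ?H" using f by (simp add: LIMSEQ_const_iff)
  qed (auto simp: distrib_left mult.left_commute[of "\<xi> _"])
  \<comment> \<open>The monotone class theorem asks for a bound at every point, so the conjugate is
    set to 0 on the null set where the essential bound fails. The bound \<open>max C 0\<close>
    covers the value 0 whatever the sign of \<open>C\<close>.\<close>
  let ?f = "\<lambda>z. if norm (\<xi> z) \<le> C then cnj (\<xi> z) else 0"
  have "?f \<in> ?H"
    by (rule bounded_measurable[where B = "max C 0"]) auto
  moreover have "AE z in torus. \<xi> z * ?f z = of_real ((norm (\<xi> z))\<^sup>2)"
    using C by eventually_elim (simp add: complex_norm_square del: of_real_power)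
  then have "(\<integral>z. \<xi> z * ?f z \<partial>torus) = (\<integral>z. of_real ((norm (\<xi> z))\<^sup>2) \<partial>torus)"
    by (intro integral_cong_AE) auto
  ultimately have "(\<integral>z. complex_of_real ((norm (\<xi> z))\<^sup>2) \<partial>torus) = 0"
    by simp
  then have "(\<integral>z. (norm (\<xi> z))\<^sup>2 \<partial>torus) = 0"
    unfolding integral_complex_of_real by simp
  moreover have "AE z in torus. norm ((norm (\<xi> z))\<^sup>2) \<le> C\<^sup>2"
    using C by eventually_elim (simp add: power_mono)
  then have "integrable torus (\<lambda>z. (norm (\<xi> z))\<^sup>2)"
    by (rule integrable_const_bound) measurable
  ultimately have "AE z in torus. (norm (\<xi> z))\<^sup>2 = 0"
    using integral_nonneg_eq_0_iff_AE[of torus "\<lambda>z. (norm (\<xi> z))\<^sup>2"] by simp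
  then show ?thesis by simp
qed

subsection \<open>Density of the monomials in the space of square integrable functions\<close>

lemma abs_L2_plus:
  "f \<in> square_integrable \<Longrightarrow> g \<in> square_integrable \<Longrightarrow> abs_L2 f + abs_L2 g = abs_L2 (\<lambda>z. f z + g z)"
  by (rule plus_L2.abs_eq) auto

lemma abs_L2_scaleC: "f \<in> square_integrable \<Longrightarrow> scaleC c (abs_L2 f) = abs_L2 (\<lambda>z. c * f z)"
  by (rule scaleC.abs_eq) auto

lemma abs_L2_M_op:
  "f \<in> square_integrable \<Longrightarrow> \<phi> \<in> Linf \<Longrightarrow> M_op \<phi> (abs_L2 f) = abs_L2 (\<lambda>z. \<phi> z * f z)"
  by (subst M_op.abs_eq) auto

lemma e_vec_eq_abs_L2: "e_vec m = abs_L2 (torus_monomial m)"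
  unfolding e_vec.abs_eq torus_monomial_def[abs_def] ..

lemma torus_monomial_square_integrable: "torus_monomial m \<in> square_integrable"
  using monomial_square_integrable[of m] by (simp add: torus_monomial_def[abs_def])

lemma abs_L2_eqI:
  assumes "f \<in> square_integrable" "g \<in> square_integrable" "AE z in torus. f z = g z"
  shows "abs_L2 f = abs_L2 g"
  using Quotient_rel_abs[OF Quotient_L2] assms by blast

lemma L2_cases:
  obtains f where "f \<in> square_integrable" "x = abs_L2 f"
  by (induction x rule: L2.abs_induct) blast

lemma abs_L2_minus:
  assumes "f \<in> square_integrable" "g \<in> square_integrable"
  shows "abs_L2 f - abs_L2 g = abs_L2 (\<lambda>z. f z - g z)"
  using assms abs_L2_plus[OF assms(1) square_integrable_cmult[OF assms(2), of "-1"]]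
  by (simp add: minus_L2_def uminus_L2_def abs_L2_scaleC)

lemma norm_abs_L2:
  assumes "f \<in> square_integrable"
  shows "(norm (abs_L2 f))\<^sup>2 = (\<integral>z. (norm (f z))\<^sup>2 \<partial>torus)"
proof -
  have "(norm (abs_L2 f))\<^sup>2 = Re (\<integral>z. f z * cnj (f z) \<partial>torus)"
    using assms by (simp add: power2_norm_eq_inner inner_L2.abs_eq)
  also have "\<dots> = (\<integral>z. (norm (f z))\<^sup>2 \<partial>torus)"
    by (simp add: complex_norm_square[symmetric] del: of_real_power)
  finally show ?thesis .
qed

text \<open>Turns dominated pointwise limits into limits in norm. Both \<open>s j\<close> and
  \<open>f\<close> are bounded by \<open>w\<close>, so the squared error is at most
  \<open>(2 * w)\<^sup>2\<close>.\<close>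

lemma L2_dominated_convergence:
  fixes s :: "nat \<Rightarrow> ('n::finite \<Rightarrow> complex) \<Rightarrow> complex"
  assumes [measurable]: "\<And>j. s j \<in> borel_measurable torus" "f \<in> borel_measurable torus"
    and w: "w \<in> borel_measurable torus" "integrable torus (\<lambda>z. (w z)\<^sup>2)"
    and bound: "\<And>j z. z \<in> space torus \<Longrightarrow> norm (s j z) \<le> w z"
    and lim: "\<And>z. z \<in> space torus \<Longrightarrow> (\<lambda>j. s j z) \<longlonglongrightarrow> f z"
  shows "s j \<in> square_integrable" "f \<in> square_integrable"
    "(\<lambda>j. abs_L2 (s j)) \<longlonglongrightarrow> abs_L2 f"
proof -
  have f_bound: "norm (f z) \<le> w z" if "z \<in> space torus" for z
    by (rule LIMSEQ_le_const2[OF tendsto_norm[OF lim[OF that]]]) (use bound[OF that] in blast)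
  have sqi: "g \<in> square_integrable"
    if [measurable]: "g \<in> borel_measurable torus" and g: "\<And>z. z \<in> space torus \<Longrightarrow> norm (g z) \<le> w z"
    for g :: "('n \<Rightarrow> complex) \<Rightarrow> complex"
  proof -
    have "integrable torus (\<lambda>z. (norm (g z))\<^sup>2)"
    proof (rule Bochner_Integration.integrable_bound[OF w(2)])
      show "AE z in torus. norm ((norm (g z))\<^sup>2) \<le> norm ((w z)\<^sup>2)"
        by (rule AE_I2) (simp add: g power_mono)
    qed measurable
    then show ?thesis by (simp add: square_integrable_def)
  qed
  show s: "s j \<in> square_integrable" for j by (rule sqi[OF _ bound]) measurable
  show f: "f \<in> square_integrable" by (rule sqi[OF _ f_bound]) measurable
  have "(\<lambda>j. \<integral>z. (norm (s j z - f z))\<^sup>2 \<partial>torus) \<longlonglongrightarrow> integral\<^sup>L torus (\<lambda>_::'n \<Rightarrow> complex. 0)"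
  proof (rule integral_dominated_convergence)
    show "integrable torus (\<lambda>z. 4 * (w z)\<^sup>2)" using w(2) by simp
    show "AE z in torus. (\<lambda>j. (norm (s j z - f z))\<^sup>2) \<longlonglongrightarrow> 0"
    proof (rule AE_I2)
      fix z :: "'n \<Rightarrow> complex" assume "z \<in> space torus"
      from tendsto_power[OF tendsto_norm[OF tendsto_diff[OF lim[OF this] tendsto_const[of "f z"]]], of 2]
      show "(\<lambda>j. (norm (s j z - f z))\<^sup>2) \<longlonglongrightarrow> 0" by simp
    qed
    show "AE z in torus. norm ((norm (s j z - f z))\<^sup>2) \<le> 4 * (w z)\<^sup>2" for j
    proof (rule AE_I2)
      fix z :: "'n \<Rightarrow> complex" assume z: "z \<in> space torus"
      have "norm (s j z - f z) \<le> 2 * w z"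
        using norm_triangle_ineq4[of "s j z" "f z"] bound[OF z, of j] f_bound[OF z] by simp
      then have "(norm (s j z - f z))\<^sup>2 \<le> (2 * w z)\<^sup>2" by (rule power_mono) simp
      then show "norm ((norm (s j z - f z))\<^sup>2) \<le> 4 * (w z)\<^sup>2" by (simp add: power_mult_distrib)
    qed
  qed simp_all
  moreover have "(\<lambda>z. s j z - f z) \<in> square_integrable" for j
    using square_integrable_add[OF s square_integrable_cmult[OF f, of "-1"]] by simp
  ultimately have "(\<lambda>j. (norm (abs_L2 (s j) - abs_L2 f))\<^sup>2) \<longlonglongrightarrow> 0"
    by (simp add: abs_L2_minus s f norm_abs_L2)
  from tendsto_real_sqrt[OF this] show "(\<lambda>j. abs_L2 (s j)) \<longlonglongrightarrow> abs_L2 f"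
    by (simp add: LIM_zero_iff tendsto_norm_zero_iff)
qed

text \<open>Totality of the monomials, in a form that suits uniqueness proofs. The monotone class
  theorem reaches the bounded functions; truncation reaches the others.\<close>

lemma closed_subspace_e_vec_UNIV:
  fixes S :: "'n::finite L2 set"
  assumes "closed S" and e: "\<And>m. e_vec m \<in> S"
    and add: "\<And>x y. x \<in> S \<Longrightarrow> y \<in> S \<Longrightarrow> x + y \<in> S"
    and scaleC: "\<And>c x. x \<in> S \<Longrightarrow> scaleC c x \<in> S"
  shows "x \<in> S"
proof -
  interpret prob_space "torus :: ('n \<Rightarrow> complex) measure" by (rule prob_space_torus)
  interpret torus_function_class "{f. f \<in> square_integrable \<and> abs_L2 f \<in> S}"
  proof
    show "torus_monomial m \<in> {f. f \<in> square_integrable \<and> abs_L2 f \<in> S}" for m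
      using e[of m] by (simp add: torus_monomial_square_integrable e_vec_eq_abs_L2)
  next
    fix f g assume "f \<in> {f. f \<in> square_integrable \<and> abs_L2 f \<in> S}"
      "g \<in> {f. f \<in> square_integrable \<and> abs_L2 f \<in> S}"
    then show "(\<lambda>z. f z + g z) \<in> {f. f \<in> square_integrable \<and> abs_L2 f \<in> S}"
      using add[of "abs_L2 f" "abs_L2 g"] by (simp add: square_integrable_add abs_L2_plus)
  next
    fix f c assume "f \<in> {f. f \<in> square_integrable \<and> abs_L2 f \<in> S}"
    then show "(\<lambda>z. c * f z) \<in> {f. f \<in> square_integrable \<and> abs_L2 f \<in> S}"
      using scaleC[of "abs_L2 f" c] by (simp add: square_integrable_cmult abs_L2_scaleC)
  next
    fix s :: "nat \<Rightarrow> ('n \<Rightarrow> complex) \<Rightarrow> complex" and f B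
    assume H: "\<And>j. s j \<in> {f. f \<in> square_integrable \<and> abs_L2 f \<in> S}"
      and s: "\<And>j. s j \<in> borel_measurable torus" and f: "f \<in> borel_measurable torus"
      and B: "\<And>j z. z \<in> space torus \<Longrightarrow> norm (s j z) \<le> B"
      and lim: "\<And>z. z \<in> space torus \<Longrightarrow> (\<lambda>j. s j z) \<longlonglongrightarrow> f z"
    have "integrable torus (\<lambda>_::'n \<Rightarrow> complex. B\<^sup>2)" by simp
    note * = L2_dominated_convergence(2,3)[OF s f borel_measurable_const this B lim]
    have "abs_L2 f \<in> S"
      by (rule closed_sequentially[OF \<open>closed S\<close> _ *(2)]) (use H in blast)
    with *(1) show "f \<in> {f. f \<in> square_integrable \<and> abs_L2 f \<in> S}" by blast
  qed
  obtain f where f: "f \<in> square_integrable" "x = abs_L2 f" by (rule L2_cases)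
  note [measurable] = f(1)[THEN square_integrable_measurable]
  \<comment> \<open>The truncations are bounded by \<open>j\<close>, hence within reach of
    \<open>bounded_measurable\<close>, and all are dominated by \<open>norm (f z)\<close>, which is
    square integrable.\<close>
  define s where "s j z = (if norm (f z) \<le> real j then f z else 0)" for j z
  have s_meas: "s j \<in> borel_measurable torus" for j unfolding s_def by measurable
  have "abs_L2 (s j) \<in> S" for j
    using bounded_measurable[OF s_meas, of j "real j"] by (auto simp: s_def)
  moreover have "(\<lambda>j. abs_L2 (s j)) \<longlonglongrightarrow> abs_L2 f"
  proof (rule L2_dominated_convergence(3)[where w = "\<lambda>z. norm (f z)"])
    show "integrable torus (\<lambda>z. (norm (f z))\<^sup>2)" using f(1) by (simp add: square_integrable_def)
    show "norm (s j z) \<le> norm (f z)" for j z by (simp add: s_def)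
    show "(\<lambda>j. s j z) \<longlonglongrightarrow> f z" for z
    proof (rule tendsto_eventually)
      have "\<forall>\<^sub>F j in sequentially. norm (f z) \<le> real j"
        using filterlim_real_sequentially by (auto simp: filterlim_at_top)
      then show "\<forall>\<^sub>F j in sequentially. s j z = f z"
        by eventually_elim (simp add: s_def)
    qed
  qed (use s_meas in measurable)
  ultimately show "x \<in> S"
    unfolding f(2) by (rule closed_sequentially[OF \<open>closed S\<close>])
qed

subsection \<open>Averaging over the fibres of the power map\<close>

text \<open>For \<open>k > 0\<close> this is the kernel of the homomorphism
  \<open>z \<mapsto> z^(-k)\<close> of the torus; the fibres of that map are its cosets.\<close>

definition unity_roots :: "int \<Rightarrow> ('n::finite \<Rightarrow> complex) set" where
  "unity_roots k = {u. \<forall>i. u i powi k = 1}"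

lemma unity_roots_subset_torus:
  assumes "k > 0" shows "unity_roots k \<subseteq> space torus"
proof
  fix u :: "'a \<Rightarrow> complex" assume "u \<in> unity_roots k"
  then have u: "u i powi k = 1" for i by (simp add: unity_roots_def)
  have "norm (u i) = 1" for i
  proof -
    have "norm (u i) ^ nat k = 1"
      using u[of i] assms by (metis norm_one norm_power power_int_def less_imp_le)
    then show ?thesis
      using power_eq_imp_eq_base[of "norm (u i)" "nat k" 1] assms by simp
  qed
  then show "u \<in> space torus" unfolding space_torus by blast
qed

lemma finite_unity_roots:
  assumes "k > 0" shows "finite (unity_roots k)"
proof -
  have "unity_roots k = (PiE UNIV (\<lambda>_. {w. w ^ nat k = 1}) :: ('a \<Rightarrow> complex) set)"
    using assms by (auto simp: unity_roots_def PiE_iff power_int_def)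
  then show ?thesis
    using assms by (simp only:) (intro finite_PiE; simp add: finite_roots_unity)
qed

lemma one_in_unity_roots: "(\<lambda>_. 1) \<in> unity_roots k"
  by (simp add: unity_roots_def)

lemma card_unity_roots_pos:
  assumes "k > 0" shows "0 < card (unity_roots k)"
  unfolding card_gt_0_iff
  by (rule conjI[OF _ finite_unity_roots[OF assms]]) (use one_in_unity_roots[of k] in force)

text \<open>Translation permutes the group. This serves twice: to make the fibre average independent
  of the chosen root, and to show that nontrivial character sums vanish.\<close>

lemma bij_betw_unity_roots_mult:
  assumes "v \<in> unity_roots k" "k > 0"
  shows "bij_betw (\<lambda>u i. u i * v i) (unity_roots k) (unity_roots k)"
proof (rule bij_betw_byWitness[where f' = "\<lambda>u i. u i / v i"])
  have nz: "v i \<noteq> 0" for i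
    using unity_roots_subset_torus[OF assms(2)] assms(1) torus_nonzero by blast
  have v: "v i powi k = 1" for i using assms(1) by (simp add: unity_roots_def)
  show "\<forall>u\<in>unity_roots k. (\<lambda>i. u i * v i / v i) = u"
    "\<forall>u\<in>unity_roots k. (\<lambda>i. u i / v i * v i) = u"
    using nz by auto
  show "(\<lambda>u i. u i * v i) ` unity_roots k \<subseteq> unity_roots k"
    "(\<lambda>u i. u i / v i) ` unity_roots k \<subseteq> unity_roots k"
    using v by (auto simp: unity_roots_def power_int_mult_distrib power_int_divide_distrib)
qed

text \<open>A Borel section of \<open>z \<mapsto> z^(-k)\<close>, taken from the principal
  logarithm; the minus sign matches the negative exponent. It jumps at the branch cut, so
  measurability is the regularity available.\<close>

definition torus_root :: "int \<Rightarrow> ('n::finite \<Rightarrow> complex) \<Rightarrow> 'n \<Rightarrow> complex" where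
  "torus_root k w i = exp (- Ln (w i) / of_int k)"

lemma measurable_torus_root: "torus_root k \<in> measurable torus torus"
proof (rule measurable_torusI)
  show "(\<lambda>w. torus_root k w i) \<in> borel_measurable torus" for i
    unfolding torus_root_def by measurable
  fix w :: "'a \<Rightarrow> complex" and i assume w: "w \<in> space torus"
  then have "norm (w i) = 1" unfolding space_torus by blast
  moreover have "w i \<noteq> 0" by (rule torus_nonzero[OF w])
  ultimately have "Re (Ln (w i)) = 0" by simp
  then show "norm (torus_root k w i) = 1" by (simp add: torus_root_def)
qed

lemma torus_root_powi:
  assumes "k \<noteq> 0" "w \<in> space torus"
  shows "torus_root k w i powi (- k) = w i"
proof -
  have "w i \<noteq> 0" by (rule torus_nonzero[OF assms(2)])
  then show ?thesis
    unfolding torus_root_def exp_power_int using assms(1) by simp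
qed

text \<open>The points \<open>u i * torus_root k w i\<close> are exactly the solutions \<open>z\<close> of \<open>z i powi (- k) = w i\<close>.\<close>

definition fibre_mean :: "int \<Rightarrow> (('n::finite \<Rightarrow> complex) \<Rightarrow> complex) \<Rightarrow> ('n \<Rightarrow> complex) \<Rightarrow> complex" where
  "fibre_mean k f w =
    (\<Sum>u\<in>unity_roots k. f (\<lambda>i. u i * torus_root k w i)) / of_nat (card (unity_roots k :: ('n \<Rightarrow> complex) set))"

lemma measurable_fibre_point:
  assumes "k > 0" "u \<in> unity_roots k"
  shows "(\<lambda>w i. u i * torus_root k w i) \<in> measurable torus torus"
  by (rule measurable_compose[OF measurable_torus_root
      measurable_torus_rotation[OF subsetD[OF unity_roots_subset_torus[OF assms(1)] assms(2)]]])

lemma measurable_fibre_mean: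
  assumes "k > 0" "f \<in> borel_measurable torus"
  shows "fibre_mean k f \<in> borel_measurable torus"
  unfolding fibre_mean_def[abs_def]
  by (intro borel_measurable_divide borel_measurable_sum borel_measurable_const
      measurable_compose[OF measurable_fibre_point assms(2)] assms(1))

lemma fibre_point_powi:
  assumes "k > 0" "w \<in> space torus" "u \<in> unity_roots k"
  shows "(u i * torus_root k w i) powi (- k) = w i"
proof -
  have "u i powi k = 1" using assms(3) by (simp add: unity_roots_def)
  then have "u i powi (- k) = 1" by (simp add: power_int_minus)
  moreover have "torus_root k w i powi (- k) = w i"
    by (rule torus_root_powi) (use assms in simp_all)
  ultimately show ?thesis by (simp only: power_int_mult_distrib mult_1)
qed

text \<open>Over \<open>w = z^(-k)\<close> the point \<open>z\<close> itself lies in the fibre. It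
  differs from the chosen root by the root of unity \<open>?v\<close>, and translating the sum by
  \<open>?v\<close> eliminates the branch.\<close>

lemma fibre_mean_power:
  fixes f :: "('n::finite \<Rightarrow> complex) \<Rightarrow> complex"
  assumes k: "k > 0" and z: "z \<in> space torus"
  shows "fibre_mean k f (\<lambda>i. z i powi (- k)) =
    (\<Sum>u\<in>unity_roots k. f (\<lambda>i. u i * z i)) / of_nat (card (unity_roots k :: ('n \<Rightarrow> complex) set))"
proof -
  let ?w = "\<lambda>i. z i powi (- k)"
  have w: "?w \<in> space torus"
    by (rule measurable_space[OF measurable_torus_power z])
  let ?v = "\<lambda>i. torus_root k ?w i / z i"
  have nz: "z i \<noteq> 0" for i by (rule torus_nonzero[OF z])
  have "?v \<in> unity_roots k"
    unfolding unity_roots_def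
  proof (intro CollectI allI)
    fix i
    have "torus_root k ?w i powi (- k) = z i powi (- k)"
      using torus_root_powi[OF _ w] k by simp
    then have "torus_root k ?w i powi k = z i powi k"
      by (simp add: power_int_minus)
    then show "(torus_root k ?w i / z i) powi k = 1"
      using nz[of i] by (simp add: power_int_divide_distrib)
  qed
  from sum.reindex_bij_betw[OF bij_betw_unity_roots_mult[OF this k], of "\<lambda>u. f (\<lambda>i. u i * z i)"]
  show ?thesis
    unfolding fibre_mean_def using nz by simp
qed

section \<open>Transport of null sets and integrals along powers and rotations\<close>

lemma AE_torus_power_iff:
  assumes "k \<noteq> 0" and [measurable]: "{z \<in> space torus. P z} \<in> sets torus"
  shows "(AE z in torus. P (\<lambda>i. z i powi k)) \<longleftrightarrow> (AE z in torus. P z)"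
  using AE_distr_iff[OF measurable_torus_power[of k] assms(2)]
  unfolding distr_torus_power[OF assms(1)] by (rule sym)

lemma AE_torus_rotation:
  assumes "u \<in> space torus" "AE z in torus. P z"
  shows "AE z in torus. P (\<lambda>i. u i * z i)"
proof (rule AE_distrD[OF measurable_torus_rotation[OF assms(1)]])
  show "AE z in distr torus torus (\<lambda>z i. u i * z i). P z"
    unfolding distr_torus_rotation[OF assms(1)] by (rule assms(2))
qed

lemma integrable_torus_power_iff:
  fixes f :: "('n::finite \<Rightarrow> complex) \<Rightarrow> complex"
  assumes "k \<noteq> 0" "f \<in> borel_measurable torus"
  shows "integrable torus (\<lambda>z. f (\<lambda>i. z i powi k)) \<longleftrightarrow> integrable torus f"
  using integrable_distr_eq[OF measurable_torus_power[of k] assms(2)] by (simp add: distr_torus_power[OF assms(1)])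

lemma integral_torus_power:
  fixes f :: "('n::finite \<Rightarrow> complex) \<Rightarrow> complex"
  assumes "k \<noteq> 0" "f \<in> borel_measurable torus"
  shows "(\<integral>z. f (\<lambda>i. z i powi k) \<partial>torus) = (\<integral>z. f z \<partial>torus)"
  using integral_distr[OF measurable_torus_power[of k] assms(2)] by (simp add: distr_torus_power[OF assms(1)])

lemma torus_rotation_integral:
  fixes f :: "('n::finite \<Rightarrow> complex) \<Rightarrow> complex"
  assumes u: "u \<in> space torus" and f: "integrable torus f"
  shows "integrable torus (\<lambda>z. f (\<lambda>i. u i * z i))"
    "(\<integral>z. f (\<lambda>i. u i * z i) \<partial>torus) = (\<integral>z. f z \<partial>torus)"
proof -
  note f' = borel_measurable_integrable[OF f]
  show "integrable torus (\<lambda>z. f (\<lambda>i. u i * z i))"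
    using integrable_distr_eq[OF measurable_torus_rotation[OF u] f'] f by (simp add: distr_torus_rotation[OF u])
  show "(\<integral>z. f (\<lambda>i. u i * z i) \<partial>torus) = (\<integral>z. f z \<partial>torus)"
    using integral_distr[OF measurable_torus_rotation[OF u] f'] by (simp add: distr_torus_rotation[OF u])
qed

text \<open>Composing with \<open>z \<mapsto> z^(-k)\<close> changes no integral and turns the fibre
  mean into an average of rotations of \<open>f\<close>, each with the same integral as
  \<open>f\<close>.\<close>

lemma fibre_mean_integral:
  fixes f :: "('n::finite \<Rightarrow> complex) \<Rightarrow> complex"
  assumes k: "k > 0" and f: "integrable torus f"
  shows "integrable torus (fibre_mean k f)"
    "(\<integral>w. fibre_mean k f w \<partial>torus) = (\<integral>z. f z \<partial>torus)"
proof -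
  let ?G = "unity_roots k :: ('n \<Rightarrow> complex) set"
  let ?P = "\<lambda>z. (\<Sum>u\<in>?G. f (\<lambda>i. u i * z i)) / of_nat (card ?G)"
  note meas = measurable_fibre_mean[OF k borel_measurable_integrable[OF f]]
  have k': "- k \<noteq> 0" using k by simp
  have G: "u \<in> space torus" if "u \<in> ?G" for u using unity_roots_subset_torus[OF k] that by blast
  note rot = torus_rotation_integral[OF G f]
  have "integrable torus ?P"
    by (intro integrable_divide Bochner_Integration.integrable_sum rot(1)) simp_all
  then have "integrable torus (\<lambda>z. fibre_mean k f (\<lambda>i. z i powi (- k)))"
    by (subst Bochner_Integration.integrable_cong[OF refl fibre_mean_power[OF k]])
  then show "integrable torus (fibre_mean k f)"
    unfolding integrable_torus_power_iff[OF k' meas] .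
  have "(\<integral>w. fibre_mean k f w \<partial>torus) = (\<integral>z. fibre_mean k f (\<lambda>i. z i powi (- k)) \<partial>torus)"
    by (rule integral_torus_power[OF k' meas, symmetric])
  also have "\<dots> = (\<integral>z. ?P z \<partial>torus)"
    by (rule Bochner_Integration.integral_cong[OF refl fibre_mean_power[OF k]])
  also have "\<dots> = (\<Sum>u\<in>?G. \<integral>z. f z \<partial>torus) / of_nat (card ?G)"
    by (subst integral_divide_zero, subst Bochner_Integration.integral_sum) (simp_all add: rot)
  also have "\<dots> = (\<integral>z. f z \<partial>torus)"
    using card_unity_roots_pos[OF k, where 'a = 'n] by simp
  finally show "(\<integral>w. fibre_mean k f w \<partial>torus) = (\<integral>z. f z \<partial>torus)" .
qed

text \<open>Cauchy-Schwarz for a finite average. The right-hand side is again a fibre mean, of the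
  squared modulus read as a complex function, so that \<open>fibre_mean_integral\<close> evaluates
  its integral and yields a contraction.\<close>

lemma norm_fibre_mean_power2:
  fixes f :: "('n::finite \<Rightarrow> complex) \<Rightarrow> complex"
  assumes k: "k > 0"
  shows "(norm (fibre_mean k f w))\<^sup>2 \<le> Re (fibre_mean k (\<lambda>z. of_real ((norm (f z))\<^sup>2)) w)"
proof -
  let ?G = "unity_roots k :: ('n \<Rightarrow> complex) set"
  let ?f = "\<lambda>u. norm (f (\<lambda>i. u i * torus_root k w i))"
  have pos: "real (card ?G) > 0" using card_unity_roots_pos[OF k] by simp
  have "norm (fibre_mean k f w) \<le> (\<Sum>u\<in>?G. ?f u) / card ?G"
    unfolding fibre_mean_def by (simp add: norm_divide divide_right_mono norm_sum)
  then have "(norm (fibre_mean k f w))\<^sup>2 \<le> ((\<Sum>u\<in>?G. ?f u) / card ?G)\<^sup>2"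
    by (rule power_mono) simp
  also have "\<dots> \<le> ((\<Sum>u\<in>?G. (?f u)\<^sup>2) * card ?G) / (real (card ?G))\<^sup>2"
    unfolding power_divide by (rule divide_right_mono[OF sum_squared_le_sum_of_squares]) simp
  also have "\<dots> = (\<Sum>u\<in>?G. (?f u)\<^sup>2) / card ?G"
    using pos by (simp add: power2_eq_square)
  also have "\<dots> = Re (fibre_mean k (\<lambda>z. of_real ((norm (f z))\<^sup>2)) w)"
    unfolding fibre_mean_def by (simp add: Re_divide_of_nat del: of_real_power)
  finally show ?thesis .
qed

lemma fibre_mean_square_integrable:
  assumes k: "k > 0" and f: "f \<in> square_integrable"
  shows "fibre_mean k f \<in> square_integrable"
    "(\<integral>w. (norm (fibre_mean k f w))\<^sup>2 \<partial>torus) \<le> (\<integral>z. (norm (f z))\<^sup>2 \<partial>torus)"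
proof -
  note [measurable] = measurable_fibre_mean[OF k square_integrable_measurable[OF f]]
  let ?g = "\<lambda>z. complex_of_real ((norm (f z))\<^sup>2)"
  have g: "integrable torus ?g"
    using f unfolding square_integrable_def by (intro integrable_of_real) blast
  note fm = fibre_mean_integral[OF k g]
  have int: "integrable torus (\<lambda>w. Re (fibre_mean k ?g w))"
    using fm(1) by (rule integrable_Re)
  have int': "integrable torus (\<lambda>w. (norm (fibre_mean k f w))\<^sup>2)"
  proof (rule Bochner_Integration.integrable_bound[OF int])
    show "AE w in torus. norm ((norm (fibre_mean k f w))\<^sup>2) \<le> norm (Re (fibre_mean k ?g w))"
      using norm_fibre_mean_power2[OF k, of f] by (intro AE_I2) (simp add: order_trans[OF _ abs_ge_self])
  qed measurable
  then show "fibre_mean k f \<in> square_integrable"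
    by (simp add: square_integrable_def)
  have "(\<integral>w. (norm (fibre_mean k f w))\<^sup>2 \<partial>torus) \<le> (\<integral>w. Re (fibre_mean k ?g w) \<partial>torus)"
    by (rule integral_mono[OF int' int norm_fibre_mean_power2[OF k]])
  also have "\<dots> = Re (\<integral>w. fibre_mean k ?g w \<partial>torus)"
    using fm(1) by simp
  also have "\<dots> = (\<integral>z. (norm (f z))\<^sup>2 \<partial>torus)"
    unfolding fm(2) integral_complex_of_real by simp
  finally show "(\<integral>w. (norm (fibre_mean k f w))\<^sup>2 \<partial>torus) \<le> (\<integral>z. (norm (f z))\<^sup>2 \<partial>torus)" .
qed

text \<open>Finitely many rotations of a null set form a null set. The detour through
  \<open>z\<close> is essential: for \<open>k \<ge> 2\<close> the values of
  \<open>torus_root k\<close> fill only a sector in each coordinate, so that map does not preserve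
  the measure.\<close>

lemma fibre_mean_cong_AE:
  fixes f g :: "('n::finite \<Rightarrow> complex) \<Rightarrow> complex"
  assumes k: "k > 0" and meas: "f \<in> borel_measurable torus" "g \<in> borel_measurable torus"
    and eq: "AE z in torus. f z = g z"
  shows "AE w in torus. fibre_mean k f w = fibre_mean k g w"
proof -
  note [measurable] = measurable_fibre_mean[OF k meas(1)] measurable_fibre_mean[OF k meas(2)]
  have "AE z in torus. \<forall>u\<in>unity_roots k. f (\<lambda>i. u i * z i) = g (\<lambda>i. u i * z i)"
  proof (rule AE_finite_allI[OF finite_unity_roots[OF k]])
    fix u :: "'n \<Rightarrow> complex" assume "u \<in> unity_roots k"
    then have "u \<in> space torus" by (rule subsetD[OF unity_roots_subset_torus[OF k]])
    from AE_torus_rotation[OF this eq]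
    show "AE z in torus. f (\<lambda>i. u i * z i) = g (\<lambda>i. u i * z i)" .
  qed
  then have "AE z in torus. fibre_mean k f (\<lambda>i. z i powi (- k)) = fibre_mean k g (\<lambda>i. z i powi (- k))"
    using AE_space
  proof eventually_elim
    case (elim z)
    have "(\<Sum>u\<in>unity_roots k. f (\<lambda>i. u i * z i)) = (\<Sum>u\<in>unity_roots k. g (\<lambda>i. u i * z i))"
      by (rule sum.cong[OF refl]) (use elim(1) in blast)
    then show ?case unfolding fibre_mean_power[OF k elim(2)] by (simp only:)
  qed
  then show ?thesis
    using AE_torus_power_iff[of "- k" "\<lambda>w. fibre_mean k f w = fibre_mean k g w"] k by simp
qed

text \<open>The factor built from \<open>a\<close> is constant on the fibre over \<open>w\<close>.
  This is the source of the commutation rule between multiplication and \<open>V\<close>.\<close>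

lemma fibre_mean_mult_power:
  fixes w :: "'n::finite \<Rightarrow> complex"
  assumes "k > 0" "w \<in> space torus"
  shows "fibre_mean k (\<lambda>z. a (\<lambda>i. z i powi (- k)) * f z) w = a w * fibre_mean k f w"
proof -
  have "(\<lambda>i. (u i * torus_root k w i) powi (- k)) = w" if "u \<in> unity_roots k" for u
    by (rule ext) (rule fibre_point_powi[OF assms that])
  then show ?thesis
    unfolding fibre_mean_def times_divide_eq_right sum_distrib_left by simp
qed

text \<open>Multiplicativity splits the average into a character sum over the roots of unity and the
  value of the monomial at the chosen root.\<close>

lemma fibre_mean_monomial:
  fixes m :: "'n::finite \<Rightarrow> int"
  assumes k: "k > 0" and w: "w \<in> space torus"
  shows "fibre_mean k (torus_monomial m) w =
    (if \<forall>i. k dvd m i then torus_monomial (\<lambda>i. - (m i div k)) w else 0)"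
proof -
  let ?G = "unity_roots k :: ('n \<Rightarrow> complex) set"
  let ?s = "\<Sum>u\<in>?G. torus_monomial m u"
  have eq: "fibre_mean k (torus_monomial m) w = ?s * torus_monomial m (torus_root k w) / of_nat (card ?G)"
    unfolding fibre_mean_def torus_monomial_mult sum_distrib_right ..
  show ?thesis
  proof (cases "\<forall>i. k dvd m i")
    case True
    define l where "l i = - (m i div k)" for i
    have m: "m = (\<lambda>i. (- k) * l i)" using True by (auto simp: l_def fun_eq_iff)
    have "torus_monomial m z = torus_monomial l (\<lambda>i. z i powi (- k))" for z
      unfolding m torus_monomial_power ..
    moreover have "torus_monomial l (\<lambda>i. u i powi (- k)) = 1" if "u \<in> ?G" for u
      using that by (simp add: unity_roots_def power_int_minus torus_monomial_def)
    moreover have "(\<lambda>i. torus_root k w i powi (- k)) = w"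
      using torus_root_powi[OF _ w] k by auto
    \<comment> \<open>The condition on \<open>u\<close> governs both facts, so \<open>root\<close>
      carries it as well; the constant vector 1 discharges it below.\<close>
    ultimately have root: "torus_monomial m (torus_root k w) = torus_monomial l w"
      and "torus_monomial m u = 1" if "u \<in> ?G" for u
      using that by metis+
    then have "?s = of_nat (card ?G)" by simp
    then show ?thesis
      using eq True root[OF one_in_unity_roots] card_unity_roots_pos[OF k, where 'a = 'n]
      by (simp add: l_def[abs_def])
  next
    case False
    then obtain i where i: "\<not> k dvd m i" by blast
    \<comment> \<open>A primitive \<open>k\<close>-th root of unity in the offending coordinate is a
      group element on which the character \<open>torus_monomial m\<close> is not 1. Translating by
      it multiplies the sum by a factor other than 1 and yet leaves it unchanged.\<close>
    define v where "v j = (if j = i then cis (2 * pi / k) else 1)" for j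
    have "v \<in> ?G"
      using k by (simp add: unity_roots_def v_def cis_power_int)
    have "torus_monomial m v = cis (2 * pi / k) powi m i"
    proof -
      have "torus_monomial m v = (\<Prod>j\<in>UNIV. if j = i then cis (2 * pi / k) powi m j else 1)"
        unfolding torus_monomial_def v_def by (rule prod.cong) auto
      then show ?thesis by simp
    qed
    also have "\<dots> = cis (2 * pi * (m i / k))"
      by (simp add: cis_power_int mult_ac)
    also have "\<dots> \<noteq> 1"
    proof
      assume "cis (2 * pi * (m i / k)) = 1"
      then have "cos (2 * pi * (m i / k)) = 1" by (metis cis.simps(1) one_complex.simps(1))
      then obtain j :: int where "2 * pi * (m i / k) = of_int j * 2 * pi"
        using cos_one_2pi_int by auto
      then have "real_of_int (m i) = of_int (j * k)" using k by (simp add: field_simps)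
      then have "m i = j * k" unfolding of_int_eq_iff .
      with i show False by simp
    qed
    finally have ne: "torus_monomial m v \<noteq> 1" .
    have "?s = (\<Sum>u\<in>?G. torus_monomial m (\<lambda>i. u i * v i))"
      by (rule sum.reindex_bij_betw[OF bij_betw_unity_roots_mult[OF \<open>v \<in> ?G\<close> k], symmetric])
    also have "\<dots> = ?s * torus_monomial m v"
      by (simp add: torus_monomial_mult sum_distrib_right)
    finally have "?s = 0" using ne by simp
    then show ?thesis using eq i by auto
  qed
qed

subsection \<open>The operators on the space of square integrable functions\<close>

text \<open>The lifted function must respect equality almost everywhere for every \<open>k\<close>.
  That is available for \<open>k > 0\<close>; the zero function fills in elsewhere.\<close>

lift_definition V_L2 :: "int \<Rightarrow> 'n::finite L2 \<Rightarrow> 'n L2" is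
  "\<lambda>k f. if k > 0 then fibre_mean k f else (\<lambda>_. 0)"
proof -
  fix k and f g :: "('n \<Rightarrow> complex) \<Rightarrow> complex"
  assume *: "f \<in> square_integrable \<and> g \<in> square_integrable \<and> (AE z in torus. f z = g z)"
  show "(if k > 0 then fibre_mean k f else (\<lambda>_. 0)) \<in> square_integrable \<and>
    (if k > 0 then fibre_mean k g else (\<lambda>_. 0)) \<in> square_integrable \<and>
    (AE z in torus. (if k > 0 then fibre_mean k f else (\<lambda>_. 0)) z = (if k > 0 then fibre_mean k g else (\<lambda>_. 0)) z)"
  proof (cases "k > 0")
    case True
    show ?thesis
      unfolding if_P[OF True]
      using * fibre_mean_cong_AE[OF True square_integrable_measurable square_integrable_measurable, of f g]
        fibre_mean_square_integrable(1)[OF True] by blast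
  qed (simp add: square_integrable_zero)
qed

text \<open>The zeroth Fourier coefficient as a functional on classes: the invariant of
  \<open>V_L2 k\<close> that detects the symbol behind two applications of it.\<close>

lift_definition L2_mean :: "'n::finite L2 \<Rightarrow> complex" is "\<lambda>f. \<integral>z. f z \<partial>torus"
  by (auto intro: integral_cong_AE square_integrable_measurable)

lemma abs_L2_V_L2:
  "k > 0 \<Longrightarrow> f \<in> square_integrable \<Longrightarrow> V_L2 k (abs_L2 f) = abs_L2 (fibre_mean k f)"
  by (subst V_L2.abs_eq) auto

lemma abs_L2_mean: "f \<in> square_integrable \<Longrightarrow> L2_mean (abs_L2 f) = (\<integral>z. f z \<partial>torus)"
  by (rule L2_mean.abs_eq) auto

lemma square_integrable_integrable:
  assumes "f \<in> square_integrable"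
  shows "integrable torus f"
proof -
  have "(\<lambda>_. 1) \<in> square_integrable"
    using torus_monomial_square_integrable[of "\<lambda>_. 0"] by (simp add: torus_monomial_0[abs_def])
  from integrable_mult_cnj[OF assms this] show ?thesis by simp
qed

lemma L2_mean_V_L2:
  assumes "k > 0"
  shows "L2_mean (V_L2 k x) = L2_mean x"
proof -
  obtain f where f: "f \<in> square_integrable" "x = abs_L2 f" by (rule L2_cases)
  show ?thesis
    unfolding f(2) abs_L2_V_L2[OF assms f(1)] abs_L2_mean[OF f(1)]
      abs_L2_mean[OF fibre_mean_square_integrable(1)[OF assms f(1)]]
    by (rule fibre_mean_integral(2)[OF assms square_integrable_integrable[OF f(1)]])
qed

lemma V_L2_e_vec:
  assumes "k > 0"
  shows "V_L2 k (e_vec m) = (if \<forall>i. k dvd m i then e_vec (\<lambda>i. - (m i div k)) else 0)"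
proof -
  define g where "g = (if \<forall>i. k dvd m i then torus_monomial (\<lambda>i. - (m i div k)) else (\<lambda>_. 0))"
  have g: "g \<in> square_integrable"
    by (simp add: g_def torus_monomial_square_integrable square_integrable_zero)
  have "AE w in torus. fibre_mean k (torus_monomial m) w = g w"
    by (rule AE_I2) (simp add: fibre_mean_monomial[OF assms] g_def)
  then have "V_L2 k (e_vec m) = abs_L2 g"
    unfolding e_vec_eq_abs_L2 abs_L2_V_L2[OF assms torus_monomial_square_integrable]
    by (rule abs_L2_eqI[OF fibre_mean_square_integrable(1)[OF assms torus_monomial_square_integrable] g])
  then show ?thesis
    by (simp add: g_def e_vec_eq_abs_L2 zero_L2_def)
qed

lemma bounded_clinear_V_L2:
  assumes k: "k > 0"
  shows "bounded_clinear (V_L2 k :: 'n::finite L2 \<Rightarrow> 'n L2)"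
proof -
  have scaleC: "V_L2 k (scaleC c x) = scaleC c (V_L2 k x)" for c and x :: "'n L2"
  proof -
    obtain f where f: "f \<in> square_integrable" "x = abs_L2 f" by (rule L2_cases)
    have "fibre_mean k (\<lambda>z. c * f z) = (\<lambda>w. c * fibre_mean k f w)"
      by (simp add: fibre_mean_def[abs_def] sum_distrib_left)
    then show ?thesis
      by (simp add: f abs_L2_scaleC abs_L2_V_L2 k fibre_mean_square_integrable square_integrable_cmult)
  qed
  have "bounded_linear (V_L2 k :: 'n L2 \<Rightarrow> 'n L2)"
  proof (rule bounded_linear_intro[where K = 1])
    fix x y :: "'n L2" and r :: real
    show "V_L2 k (r *\<^sub>R x) = r *\<^sub>R V_L2 k x"
      by (simp add: scaleR_L2_def scaleC)
    obtain f g where f: "f \<in> square_integrable" "x = abs_L2 f"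
      and g: "g \<in> square_integrable" "y = abs_L2 g"
      using L2_cases[of x] L2_cases[of y] by metis
    have "fibre_mean k (\<lambda>z. f z + g z) = (\<lambda>w. fibre_mean k f w + fibre_mean k g w)"
      by (simp add: fibre_mean_def[abs_def] sum.distrib add_divide_distrib)
    then show "V_L2 k (x + y) = V_L2 k x + V_L2 k y"
      by (simp add: f g abs_L2_plus abs_L2_V_L2 k fibre_mean_square_integrable square_integrable_add)
    have "(norm (V_L2 k x))\<^sup>2 \<le> (norm x)\<^sup>2"
      unfolding f(2) abs_L2_V_L2[OF k f(1)] norm_abs_L2[OF f(1)]
        norm_abs_L2[OF fibre_mean_square_integrable(1)[OF k f(1)]]
      by (rule fibre_mean_square_integrable(2)[OF k f(1)])
    then show "norm (V_L2 k x) \<le> norm x * 1"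
      using power2_le_imp_le[of "norm (V_L2 k x)" "norm x"] by simp
  qed
  with scaleC show ?thesis unfolding bounded_clinear_def by blast
qed

text \<open>By continuity and linearity the set where both operators agree is a closed complex
  subspace, and it contains every \<open>e_vec m\<close>.\<close>

lemma bounded_clinear_eqI:
  fixes T U :: "'n::finite L2 \<Rightarrow> 'n L2"
  assumes T: "bounded_clinear T" and U: "bounded_clinear U"
    and eq: "\<And>m. T (e_vec m) = U (e_vec m)"
  shows "T = U"
proof
  fix x
  have lin: "bounded_linear T" "bounded_linear U"
    using T U unfolding bounded_clinear_def by blast+
  have "x \<in> {x. T x = U x}"
  proof (rule closed_subspace_e_vec_UNIV)
    show "closed {x. T x = U x}"
      by (intro closed_Collect_eq linear_continuous_on lin)
    fix x y c assume x: "x \<in> {x. T x = U x}" and y: "y \<in> {x. T x = U x}"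
    show "x + y \<in> {x. T x = U x}"
      using x y by (simp add: linear_add bounded_linear.linear lin)
    show "scaleC c x \<in> {x. T x = U x}"
      using x T U by (simp add: bounded_clinear_def)
  qed (simp add: eq)
  then show "T x = U x" by simp
qed

text \<open>Resolves the definite description: the fibre mean provides existence, and totality of
  the monomials provides uniqueness.\<close>

lemma V_op_eq_V_L2:
  assumes k: "k > 0"
  shows "V_op k = (V_L2 k :: 'n::finite L2 \<Rightarrow> 'n L2)"
  unfolding V_op_def
proof (rule the_equality)
  show "bounded_clinear (V_L2 k :: 'n L2 \<Rightarrow> 'n L2) \<and>
    (\<forall>m. V_L2 k (e_vec m :: 'n L2) = (if \<forall>i. k dvd m i then e_vec (\<lambda>i. - (m i div k)) else 0))"
    using bounded_clinear_V_L2[OF k] V_L2_e_vec[OF k] by blast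
  fix V :: "'n L2 \<Rightarrow> 'n L2"
  assume "bounded_clinear V \<and>
    (\<forall>m. V (e_vec m) = (if \<forall>i. k dvd m i then e_vec (\<lambda>i. - (m i div k)) else 0))"
  then show "V = V_L2 k"
    by (intro bounded_clinear_eqI bounded_clinear_V_L2[OF k]) (simp_all add: V_L2_e_vec[OF k])
qed

section \<open>Essentially bounded symbols and their multiplication operators\<close>

lemma Linf_power:
  assumes "k \<noteq> 0" and \<phi>: "\<phi> \<in> Linf"
  shows "(\<lambda>z. \<phi> (\<lambda>i. z i powi k)) \<in> Linf"
proof -
  have [measurable]: "\<phi> \<in> borel_measurable torus" using \<phi> by (simp add: Linf_def)
  obtain C where "AE z in torus. norm (\<phi> z) \<le> C" using \<phi> by (auto simp: Linf_def)
  then have "AE z in torus. norm (\<phi> (\<lambda>i. z i powi k)) \<le> C"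
    using AE_torus_power_iff[OF assms(1), of "\<lambda>z. norm (\<phi> z) \<le> C"] by simp
  moreover have "(\<lambda>z. \<phi> (\<lambda>i. z i powi k)) \<in> borel_measurable torus"
    by (rule measurable_compose[OF measurable_torus_power]) measurable
  ultimately show ?thesis unfolding Linf_def by blast
qed

lemma Linf_mult:
  assumes \<phi>: "\<phi> \<in> Linf" and \<psi>: "\<psi> \<in> Linf"
  shows "(\<lambda>z. \<phi> z * \<psi> z) \<in> Linf"
proof -
  obtain C D where "AE z in torus. norm (\<phi> z) \<le> C" "AE z in torus. norm (\<psi> z) \<le> D"
    using assms unfolding Linf_def by blast
  then have "AE z in torus. norm (\<phi> z * \<psi> z) \<le> C * D"
    by eventually_elim (simp add: norm_mult mult_mono order_trans[OF norm_ge_zero])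
  with assms show ?thesis unfolding Linf_def by auto
qed

lemma Linf_diff:
  assumes \<phi>: "\<phi> \<in> Linf" and \<psi>: "\<psi> \<in> Linf"
  shows "(\<lambda>z. \<phi> z - \<psi> z) \<in> Linf"
proof -
  obtain C D where "AE z in torus. norm (\<phi> z) \<le> C" "AE z in torus. norm (\<psi> z) \<le> D"
    using assms unfolding Linf_def by blast
  then have "AE z in torus. norm (\<phi> z - \<psi> z) \<le> C + D"
    by eventually_elim (rule order_trans[OF norm_triangle_ineq4 add_mono])
  with assms show ?thesis unfolding Linf_def by auto
qed

lemma M_op_V_L2:
  assumes k: "k > 0" and \<phi>: "\<phi> \<in> Linf"
  shows "M_op \<phi> (V_L2 k x) = V_L2 k (M_op (\<lambda>z. \<phi> (\<lambda>i. z i powi (- k))) x)"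
proof -
  obtain f where f: "f \<in> square_integrable" "x = abs_L2 f" by (rule L2_cases)
  let ?\<phi> = "\<lambda>z. \<phi> (\<lambda>i. z i powi (- k))"
  have \<phi>': "?\<phi> \<in> Linf" using k by (intro Linf_power \<phi>) simp
  note \<phi>f = square_integrable_Linf_mult[OF \<phi>' f(1)]
  note Vf = fibre_mean_square_integrable(1)[OF k f(1)]
  have "AE w in torus. \<phi> w * fibre_mean k f w = fibre_mean k (\<lambda>z. ?\<phi> z * f z) w"
    by (rule AE_I2) (rule fibre_mean_mult_power[OF k, symmetric])
  then show ?thesis
    unfolding f(2) abs_L2_V_L2[OF k f(1)] abs_L2_M_op[OF Vf \<phi>] abs_L2_M_op[OF f(1) \<phi>']
      abs_L2_V_L2[OF k \<phi>f]
    by (rule abs_L2_eqI[OF square_integrable_Linf_mult[OF \<phi> Vf]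
          fibre_mean_square_integrable(1)[OF k \<phi>f]])
qed

lemma M_op_M_op:
  assumes "\<phi> \<in> Linf" "\<psi> \<in> Linf"
  shows "M_op \<phi> (M_op \<psi> x) = M_op (\<lambda>z. \<phi> z * \<psi> z) x"
proof -
  obtain f where f: "f \<in> square_integrable" "x = abs_L2 f" by (rule L2_cases)
  show ?thesis
    by (simp add: f abs_L2_M_op square_integrable_Linf_mult Linf_mult assms mult.assoc)
qed

lemma M_op_cong_AE:
  assumes "\<phi> \<in> Linf" "\<psi> \<in> Linf" "AE z in torus. \<phi> z = \<psi> z"
  shows "M_op \<phi> x = M_op \<psi> x"
proof -
  obtain f where f: "f \<in> square_integrable" "x = abs_L2 f" by (rule L2_cases)
  have "AE z in torus. \<phi> z * f z = \<psi> z * f z"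
    using assms(3) by eventually_elim simp
  then show ?thesis
    unfolding f(2) abs_L2_M_op[OF f(1) assms(1)] abs_L2_M_op[OF f(1) assms(2)]
    by (rule abs_L2_eqI[OF square_integrable_Linf_mult[OF assms(1) f(1)]
          square_integrable_Linf_mult[OF assms(2) f(1)]])
qed

lemma S_op_S_op:
  assumes "k > 0" "\<phi> \<in> Linf" "\<psi> \<in> Linf"
  shows "S_op k \<phi> (S_op k \<psi> x) = V_L2 k (V_L2 k (M_op (\<lambda>z. \<phi> (\<lambda>i. z i powi (- k)) * \<psi> z) x))"
proof -
  have "(\<lambda>z. \<phi> (\<lambda>i. z i powi (- k))) \<in> Linf" using assms by (intro Linf_power) auto
  then show ?thesis
    unfolding S_op_def V_op_eq_V_L2[OF assms(1)] o_apply M_op_V_L2[OF assms(1,2)]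
    by (simp only: M_op_M_op assms(3))
qed

text \<open>Multiplication by the monomial shifts the coefficient of \<phi> at \<open>-m\<close>
  into the zeroth position, where \<open>L2_mean\<close> reads it.\<close>

lemma L2_mean_M_op_e_vec:
  assumes "\<phi> \<in> Linf"
  shows "L2_mean (M_op \<phi> (e_vec m)) = (\<integral>z. \<phi> z * torus_monomial m z \<partial>torus)"
  by (simp add: e_vec_eq_abs_L2 abs_L2_M_op abs_L2_mean torus_monomial_square_integrable
      square_integrable_Linf_mult assms)

theorem theorem3p7:
  fixes k :: int and \<phi> \<psi> :: "('n::finite \<Rightarrow> complex) \<Rightarrow> complex"
  assumes "k \<ge> 2" and "\<phi> \<in> Linf" and "\<psi> \<in> Linf"
  shows "S_op k \<phi> \<circ> S_op k \<psi> = S_op k \<psi> \<circ> S_op k \<phi> \<longleftrightarrow>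
    (AE z in torus. \<phi> (\<lambda>i. z i powi (- k)) * \<psi> z = \<psi> (\<lambda>i. z i powi (- k)) * \<phi> z)"
proof -
  have k: "k > 0" "- k \<noteq> 0" using assms(1) by simp_all
  define a where "a z = \<phi> (\<lambda>i. z i powi (- k)) * \<psi> z" for z
  define b where "b z = \<psi> (\<lambda>i. z i powi (- k)) * \<phi> z" for z
  have a: "a \<in> Linf" unfolding a_def[abs_def] by (intro Linf_mult Linf_power k assms)
  have b: "b \<in> Linf" unfolding b_def[abs_def] by (intro Linf_mult Linf_power k assms)
  have comp: "(S_op k \<phi> \<circ> S_op k \<psi>) x = V_L2 k (V_L2 k (M_op a x))"
    "(S_op k \<psi> \<circ> S_op k \<phi>) x = V_L2 k (V_L2 k (M_op b x))" for x
    unfolding o_apply a_def[abs_def] b_def[abs_def] using k(1) assms by (simp_all only: S_op_S_op)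
  have "S_op k \<phi> \<circ> S_op k \<psi> = S_op k \<psi> \<circ> S_op k \<phi> \<longleftrightarrow> (AE z in torus. a z = b z)"
  proof
    assume "AE z in torus. a z = b z"
    then show "S_op k \<phi> \<circ> S_op k \<psi> = S_op k \<psi> \<circ> S_op k \<phi>"
      by (intro ext) (simp only: comp M_op_cong_AE[OF a b])
  next
    assume eq: "S_op k \<phi> \<circ> S_op k \<psi> = S_op k \<psi> \<circ> S_op k \<phi>"
    have "AE z in torus. a z - b z = 0"
    proof (rule Linf_eq_0_AE[OF Linf_diff[OF a b]])
      fix m :: "'n \<Rightarrow> int"
      \<comment> \<open>Taking the mean strips off both copies of \<open>V_L2 k\<close> without
        inverting them.\<close>
      have "L2_mean (V_L2 k (V_L2 k (M_op a (e_vec m)))) = L2_mean (V_L2 k (V_L2 k (M_op b (e_vec m))))"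
        unfolding comp[symmetric] eq ..
      then have "(\<integral>z. a z * torus_monomial m z \<partial>torus) = (\<integral>z. b z * torus_monomial m z \<partial>torus)"
        unfolding L2_mean_V_L2[OF k(1)] L2_mean_M_op_e_vec[OF a] L2_mean_M_op_e_vec[OF b] .
      moreover have "integrable torus (\<lambda>z. \<xi> z * torus_monomial m z)" if "\<xi> \<in> Linf" for \<xi>
        by (intro square_integrable_integrable square_integrable_Linf_mult that
            torus_monomial_square_integrable)
      ultimately show "(\<integral>z. (a z - b z) * torus_monomial m z \<partial>torus) = 0"
        using a b by (simp add: left_diff_distrib Bochner_Integration.integral_diff)
    qed
    then show "AE z in torus. a z = b z" by simp
  qed
  then show ?thesis unfolding a_def b_def .
qed

end
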